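(* Let $n\ge 2$. For all $a,b\in\mathscr P\mathcal P_n^{\mathrm{fd}}$ the following hold: (G1) $a\rho(a)=a$; (G2) $\rho(\rho(a))=\rho(a)$; (G3) $\rho(a)\rho(a)=\rho(a)$; (G4) $\rho(a)\rho(b)\rho(a)=\rho(b)\rho(a)$; (G5) $\rho(\rho(a)\rho(b))=\rho(a)\rho(b)$; (G6) $\rho(ab)\rho(b)=\rho(ab)$; (G7) $\rho(ab)=\rho(\rho(a)b)$; (G8) $\rho(a)b=b\rho(ab)$.
   Context: Partition monoid: let $\mathbf n=\{1,\dots,n\}$, and let $\mathbf n'=\{1',\dots,n'\}$ and $\mathbf n''=\{1'',\dots,n''\}$ be disjoint copies of $\mathbf n$; for $A\subseteq\mathbf n$ write $A'=\{x':x\in A\}$. The partition monoid $\mathcal P_n$ is the set of all set partitions of $\mathbf n\cup\mathbf n'$, with product defined as follows. For $a,b\in\mathcal P_n$, let $a^\downarrow$ be the partition of $\mathbf n\cup\mathbf n''$ obtained from $a$ by renaming each $x'$ as $x''$, and $b^\uparrow$ the partition of $\mathbf n''\cup\mathbf n'$ obtained from $b$ by renaming each $x\in\mathbf n$ as $x''$. Then $x,y\in\mathbf n\cup\mathbf n'$ belong to the same block of $ab$ iff they are related by the smallest equivalence relation on $\mathbf n\cup\mathbf n''\cup\mathbf n'$ that relates any two elements lying in a common block of $a^\downarrow$ or of $b^\uparrow$. The identity is the partition $1$ with blocks $\{x,x'\}$, $x\in\mathbf n$. A partition $a\in\mathcal P_n$ is full-domain if every element of $\mathbf n$ lies in a block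 of $a$ containing at least one element of $\mathbf n'$. It is planar if, with vertices $1<\dots<n$ placed on an upper row and $1'<\dots<n'$ on a lower row (increasing from left to right), there is a graph on these vertices whose connected components are the blocks of $a$ and which can be drawn with all edges inside the rectangle spanned by the vertices and with no edge crossings. $\mathscr P\mathcal P_n^{\mathrm{fd}}$ is the submonoid of $\mathcal P_n$ of all planar full-domain partitions. The cokernel of $a$ is the equivalence $\mathrm{coker}(a)=\{(x,y)\in\mathbf n\times\mathbf n: x',y'\text{ lie in the same block of }a\}$. For non-empty $A,B\subseteq\mathbf n$, $A$ and $B$ are separated if $\max A<\min B$ or $\max B<\min A$; $A$ is nested by $B=\{j_1<\dots<j_l\}$ if $j_t<\min A\le\max A<j_{t+1}$ for some $1\le t<l$; $A,B$ are nested if one is nested by the other. An equivalence relation $\eta$ on $\mathbf n$ is planar if every pair of distinct $\eta$-classes is separated or nested; the cokernel of any planar partition is a planar equivalence. Given planar $\eta$, let $B_1<\dots<B_r$ be the $\eta$-classes not nested by any other $\eta$-class (listed so that $\max B_i<\min B_{i+1}$), let $C_1,\dots,C_s$ be the remaining classes, and let $A_i=\{x\in\mathbf n:\min B_i\le x\le\max B_i\}$. Then $d_\eta\in\mathscr P\mathcal P_n^{\mathrm{fd}}$ is the partition with blocks $A_i\cup B_i'$ ($1\le i\le r$) and $C_j'$ ($1\le j\le s$). The unary operation $\rho$ on $\mathscr P\mathcal P_n^{\mathrm{fd}}$ is defined by $\rho(a)=d_{\mathrm{coker}(a)}$. *)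

theory Defs
  imports "HOL-Analysis.Analysis" "HOL-Library.Disjoint_Sets"
begin

text \<open>The constructors give three disjoint copies of the natural numbers:
  \<open>Up x\<close> is \<open>x\<close>, \<open>Low x\<close> is \<open>x'\<close>, and \<open>Mid x\<close> is \<open>x''\<close>.\<close>

datatype vertex = Up nat | Mid nat | Low nat

type_synonym partition = "vertex set set"

definition vertices :: "nat \<Rightarrow> vertex set" where
  "vertices n = Up ` {1..n} \<union> Low ` {1..n}"

definition partitions :: "nat \<Rightarrow> partition set" where
  "partitions n = {a. partition_on (vertices n) a}"

fun low_to_mid :: "vertex \<Rightarrow> vertex" where
  "low_to_mid (Low x) = Mid x"
| "low_to_mid v = v"

fun up_to_mid :: "vertex \<Rightarrow> vertex" where
  "up_to_mid (Up x) = Mid x"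
| "up_to_mid v = v"

definition down :: "partition \<Rightarrow> partition" where
  "down a = (\<lambda>B. low_to_mid ` B) ` a"

definition up :: "partition \<Rightarrow> partition" where
  "up b = (\<lambda>B. up_to_mid ` B) ` b"

text \<open>The smallest equivalence relation, as the intersection of all equivalence relations
  with the required property; the total relation is one of them when \<open>a\<close> and \<open>b\<close>
  are in \<open>partitions n\<close>.\<close>

definition prod_rel :: "nat \<Rightarrow> partition \<Rightarrow> partition \<Rightarrow> vertex rel" where
  "prod_rel n a b = \<Inter>{r. equiv (Up ` {1..n} \<union> Mid ` {1..n} \<union> Low ` {1..n}) r
                          \<and> (\<forall>B \<in> down a \<union> up b. B \<times> B \<subseteq> r)}"

definition part_mult :: "partition \<Rightarrow> nat \<Rightarrow> partition \<Rightarrow> partition"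
  (\<open>(_ \<odot>\<^bsub>_\<^esub> _)\<close> [70, 0, 71] 70) where
  "a \<odot>\<^bsub>n\<^esub> b = vertices n // (prod_rel n a b \<inter> vertices n \<times> vertices n)"

definition full_domain :: "nat \<Rightarrow> partition \<Rightarrow> bool" where
  "full_domain n a \<longleftrightarrow> (\<forall>x \<in> {1..n}. \<exists>B \<in> a. Up x \<in> B \<and> (\<exists>y \<in> {1..n}. Low y \<in> B))"

primrec (nonexhaustive) pos :: "vertex \<Rightarrow> real^2" where
  "pos (Up x) = vector [real x, 1]"
| "pos (Low x) = vector [real x, 0]"

definition graph_components :: "'v set \<Rightarrow> 'v set set \<Rightarrow> 'v set set" where
  "graph_components V E = V // {(u, v) \<in> V \<times> V. (u, v) \<in> {(x, y). {x, y} \<in> E}\<^sup>*}"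

text \<open>Edges are drawn as simple arcs (not necessarily straight segments) inside the rectangle.
  An arc meets the vertices only in its own two endpoints, and distinct arcs meet only in
  endpoints that they share.\<close>

definition planar_drawing :: "nat \<Rightarrow> vertex set set \<Rightarrow> (vertex set \<Rightarrow> real \<Rightarrow> real^2) \<Rightarrow> bool" where
  "planar_drawing n E \<gamma> \<longleftrightarrow>
     (\<forall>e \<in> E. arc (\<gamma> e)
        \<and> {pathstart (\<gamma> e), pathfinish (\<gamma> e)} = pos ` e
        \<and> path_image (\<gamma> e) \<subseteq> cbox (vector [1, 0]) (vector [real n, 1])
        \<and> path_image (\<gamma> e) \<inter> pos ` vertices n \<subseteq> pos ` e)
   \<and> (\<forall>e \<in> E. \<forall>f \<in> E. e \<noteq> f \<longrightarrow> path_image (\<gamma> e) \<inter> path_image (\<gamma> f) \<subseteq> pos ` (e \<inter> f))"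

definition planar_partition :: "nat \<Rightarrow> partition \<Rightarrow> bool" where
  "planar_partition n a \<longleftrightarrow>
     (\<exists>E \<gamma>. E \<subseteq> {{u, v} | u v. u \<in> vertices n \<and> v \<in> vertices n \<and> u \<noteq> v}
          \<and> graph_components (vertices n) E = a
          \<and> planar_drawing n E \<gamma>)"

definition planar_fd :: "nat \<Rightarrow> partition set" where
  "planar_fd n = {a \<in> partitions n. planar_partition n a \<and> full_domain n a}"

definition coker :: "nat \<Rightarrow> partition \<Rightarrow> nat rel" where
  "coker n a = {(x, y) \<in> {1..n} \<times> {1..n}. \<exists>B \<in> a. Low x \<in> B \<and> Low y \<in> B}"

definition nested_by :: "nat set \<Rightarrow> nat set \<Rightarrow> bool" where
  "nested_by A B \<longleftrightarrow>
     (let j = sorted_list_of_set B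
      in \<exists>t. Suc t < length j \<and> j ! t < Min A \<and> Max A < j ! Suc t)"

definition outer_classes :: "nat \<Rightarrow> nat rel \<Rightarrow> nat set set" where
  "outer_classes n \<eta> = {B \<in> {1..n} // \<eta>. \<forall>C \<in> {1..n} // \<eta>. C \<noteq> B \<longrightarrow> \<not> nested_by B C}"

text \<open>Meaningful for planar \<open>\<eta>\<close> only: then the intervals \<open>{Min B..Max B}\<close> spanned by the
  outer classes \<open>B\<close> partition \<open>{1..n}\<close>.\<close>

definition d :: "nat \<Rightarrow> nat rel \<Rightarrow> partition" where
  "d n \<eta> = (\<lambda>B. Up ` {Min B..Max B} \<union> Low ` B) ` outer_classes n \<eta>
         \<union> (\<lambda>C. Low ` C) ` ({1..n} // \<eta> - outer_classes n \<eta>)"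

definition \<rho> :: "nat \<Rightarrow> partition \<Rightarrow> partition" where
  "\<rho> n a = d n (coker n a)"

end

theory Submission
  imports Defs
begin

text \<open>
  A full-domain partition is encoded by its cokernel \<open>\<eta>\<close> and a map \<open>\<phi>\<close> on \<open>{1..n}\<close> attaching every
  upper vertex \<open>u\<close> to the lower vertex \<open>\<phi> u\<close>, where \<open>\<phi>\<close> matters only up to \<open>\<eta>\<close>. In this encoding
  \<open>(\<phi>, \<eta>) (\<psi>, \<theta>) = (\<psi> \<circ> \<phi>, \<theta> \<squnion> \<psi>(\<eta>))\<close> and \<open>\<rho> (\<phi>, \<eta>) = (m\<^sub>\<eta>, \<eta>)\<close>, with \<open>m\<^sub>\<eta> x\<close> the minimum of the outer
  \<open>\<eta>\<close>-class spanning \<open>x\<close>. The Fashoda theorem turns a planar drawing into combinatorics: \<open>\<eta>\<close> is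
  noncrossing, and \<open>\<phi>\<close> can be chosen monotone with all values in outer classes. Such pairs are
  closed under products and \<open>\<rho>\<close>, so (G1), (G2), (G5), (G7) and (G8) reduce to facts about \<open>m\<^sub>\<eta>\<close>; the main
  one is that \<open>\<psi> (m\<^sub>\<eta> u)\<close> and \<open>m\<^sub>c (\<psi> u)\<close> are \<open>c\<close>-related for \<open>c = \<theta> \<squnion> \<psi>(\<eta>)\<close>. The other laws are formal
  consequences of these and associativity.
\<close>

section \<open>Noncrossing equivalences\<close>

text \<open>For an equivalence this is planarity: two distinct classes that are neither separated
  nor nested contain an interleaved quadruple, and conversely.\<close>

definition noncrossing :: "nat rel \<Rightarrow> bool" where
  "noncrossing \<eta> \<longleftrightarrow> (\<forall>p q r s. p < q \<and> q < r \<and> r < s \<and> (p, r) \<in> \<eta> \<and> (q, s) \<in> \<eta> \<longrightarrow> (p, q) \<in> \<eta>)"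

text \<open>For noncrossing \<open>\<eta>\<close>, \<open>exposed \<eta> x\<close> says that the class of \<open>x\<close> is an outer class,
  and \<open>hull_min \<eta> x\<close> is the minimum of the outer class whose span contains \<open>x\<close>.\<close>

definition exposed :: "nat rel \<Rightarrow> nat \<Rightarrow> bool" where
  "exposed \<eta> x \<longleftrightarrow> (\<forall>p q. p < x \<and> x < q \<and> (p, q) \<in> \<eta> \<longrightarrow> (p, x) \<in> \<eta>)"

definition admissible :: "nat \<Rightarrow> (nat \<Rightarrow> nat) \<Rightarrow> nat rel \<Rightarrow> bool" where
  "admissible n \<phi> \<eta> \<longleftrightarrow> equiv {1..n} \<eta> \<and> noncrossing \<eta> \<and> \<phi> \<in> {1..n} \<rightarrow> {1..n}
     \<and> mono_on {1..n} \<phi> \<and> (\<forall>u\<in>{1..n}. exposed \<eta> (\<phi> u))"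

definition hull_min :: "nat rel \<Rightarrow> nat \<Rightarrow> nat" where
  "hull_min \<eta> x = (LEAST y. \<exists>z. y \<le> x \<and> x \<le> z \<and> (y, z) \<in> \<eta>)"

text \<open>In a product, \<open>\<psi>\<close> carries the connections \<open>\<eta>\<close> of the
  middle row down to the lower row, where they merge with \<open>\<theta>\<close>. For equivalences
  the transitive closure is already the join: the union is symmetric, and \<open>\<theta>\<close>
  supplies reflexivity.\<close>

definition join_image :: "(nat \<Rightarrow> nat) \<Rightarrow> nat rel \<Rightarrow> nat rel \<Rightarrow> nat rel" where
  "join_image \<psi> \<theta> \<eta> = (\<theta> \<union> map_prod \<psi> \<psi> ` \<eta>)\<^sup>+"

lemma admissibleD:
  assumes "admissible n \<phi> \<eta>"
  shows "equiv {1..n} \<eta>" "noncrossing \<eta>" "\<phi> \<in> {1..n} \<rightarrow> {1..n}" "u \<in> {1..n} \<Longrightarrow> exposed \<eta> (\<phi> u)"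
  using assms by (simp_all only: admissible_def)

lemma equiv_memD:
  assumes "equiv A \<eta>" "(x, y) \<in> \<eta>"
  shows "x \<in> A" "y \<in> A" "(y, x) \<in> \<eta>"
  using assms by (auto simp: equiv_def refl_on_def sym_def)

lemma equiv_transD: "equiv A \<eta> \<Longrightarrow> (x, y) \<in> \<eta> \<Longrightarrow> (y, z) \<in> \<eta> \<Longrightarrow> (x, z) \<in> \<eta>"
  by (meson equivE transE)

lemma equiv_reflD: "equiv A \<eta> \<Longrightarrow> x \<in> A \<Longrightarrow> (x, x) \<in> \<eta>"
  by (meson equivE refl_onD)

lemma noncrossingD:
  "noncrossing \<eta> \<Longrightarrow> (p, r) \<in> \<eta> \<Longrightarrow> (q, s) \<in> \<eta> \<Longrightarrow> p < q \<Longrightarrow> q < r \<Longrightarrow> r < s \<Longrightarrow> (p, q) \<in> \<eta>"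
  unfolding noncrossing_def by blast

lemma exposedD: "exposed \<eta> x \<Longrightarrow> (p, q) \<in> \<eta> \<Longrightarrow> p < x \<Longrightarrow> x < q \<Longrightarrow> (p, x) \<in> \<eta>"
  unfolding exposed_def by blast

lemma hull_minE:
  assumes "equiv A \<eta>" "x \<in> A"
  obtains z where "hull_min \<eta> x \<le> x" "x \<le> z" "(hull_min \<eta> x, z) \<in> \<eta>"
  using LeastI_ex[of "\<lambda>y. \<exists>z. y \<le> x \<and> x \<le> z \<and> (y, z) \<in> \<eta>"] equiv_reflD[OF assms] that
  unfolding hull_min_def by blast

lemma hull_min_le: "y \<le> x \<Longrightarrow> x \<le> z \<Longrightarrow> (y, z) \<in> \<eta> \<Longrightarrow> hull_min \<eta> x \<le> y"
  unfolding hull_min_def by (rule Least_le) blast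

lemma hull_min_mem: "equiv A \<eta> \<Longrightarrow> x \<in> A \<Longrightarrow> hull_min \<eta> x \<in> A"
  by (meson equiv_memD(1) hull_minE)

lemma hull_min_mono:
  assumes "equiv A \<eta>" "x \<in> A" "y \<in> A" "x \<le> y"
  shows "hull_min \<eta> x \<le> hull_min \<eta> y"
proof -
  obtain z where z: "hull_min \<eta> y \<le> y" "y \<le> z" "(hull_min \<eta> y, z) \<in> \<eta>"
    using hull_minE[OF assms(1,3)] .
  obtain w where w: "hull_min \<eta> x \<le> x"
    using hull_minE[OF assms(1,2)] .
  show ?thesis
    using hull_min_le[of "hull_min \<eta> y" x z \<eta>] z w assms(4) by linarith
qed

text \<open>If the chord from \<open>hull_min \<eta> p\<close> to \<open>v\<close> over
  \<open>p\<close> stops short of a related point \<open>q > p\<close>, then noncrossing or a shared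
  endpoint puts \<open>q\<close> into the class of \<open>hull_min \<eta> p\<close>. In either case
  a chord starting there also spans \<open>q\<close>.\<close>

lemma hull_min_eq:
  assumes eq: "equiv A \<eta>" and nc: "noncrossing \<eta>" and xy: "(x, y) \<in> \<eta>"
  shows "hull_min \<eta> x = hull_min \<eta> y"
proof -
  have *: "hull_min \<eta> p = hull_min \<eta> q" if pq: "(p, q) \<in> \<eta>" and "p < q" for p q
  proof (rule antisym)
    show "hull_min \<eta> p \<le> hull_min \<eta> q"
      using hull_min_mono[OF eq] equiv_memD[OF eq pq] \<open>p < q\<close> by simp
    obtain v where v: "hull_min \<eta> p \<le> p" "p \<le> v" "(hull_min \<eta> p, v) \<in> \<eta>"
      using hull_minE[OF eq equiv_memD(1)[OF eq pq]] .
    have "q \<le> v \<or> (hull_min \<eta> p, q) \<in> \<eta>"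
      using noncrossingD[OF nc v(3) pq] v pq equiv_transD[OF eq]
      by (metis le_neq_implies_less not_le)
    then show "hull_min \<eta> q \<le> hull_min \<eta> p"
      using hull_min_le[of "hull_min \<eta> p" q] v \<open>p < q\<close> by (meson le_trans less_imp_le order_refl)
  qed
  show ?thesis
    using *[OF xy] *[OF equiv_memD(3)[OF eq xy]] by (metis linorder_neqE_nat)
qed

text \<open>Monotonicity squeezes the value at \<open>y\<close> between the equal values at
  \<open>x\<close> and \<open>z\<close>.\<close>

lemma hull_min_between:
  assumes "equiv A \<eta>" "noncrossing \<eta>" "(x, z) \<in> \<eta>" "y \<in> A" "x \<le> y" "y \<le> z"
  shows "hull_min \<eta> y = hull_min \<eta> x"
  using hull_min_mono[OF assms(1) _ assms(4,5)] hull_min_mono[OF assms(1,4) _ assms(6)]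
    hull_min_eq[OF assms(1,2,3)] equiv_memD[OF assms(1,3)] by simp

lemma hull_min_related:
  assumes eq: "equiv A \<eta>" and x: "x \<in> A" and ex: "exposed \<eta> x"
  shows "(hull_min \<eta> x, x) \<in> \<eta>"
proof -
  obtain z where z: "hull_min \<eta> x \<le> x" "x \<le> z" "(hull_min \<eta> x, z) \<in> \<eta>"
    using hull_minE[OF eq x] .
  \<comment> \<open>Either \<open>x\<close> is an endpoint of the chord, or it lies strictly under
    it and exposure applies.\<close>
  show ?thesis
    using exposedD[OF ex z(3)] z equiv_reflD[OF eq x]  by (metis le_neq_implies_less)
qed

lemma exposed_hull_min:
  assumes eq: "equiv A \<eta>" and nc: "noncrossing \<eta>" and x: "x \<in> A"
  shows "exposed \<eta> (hull_min \<eta> x)"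
  unfolding exposed_def
proof (intro allI impI)
  fix p q assume pq: "p < hull_min \<eta> x \<and> hull_min \<eta> x < q \<and> (p, q) \<in> \<eta>"
  obtain z where z: "hull_min \<eta> x \<le> x" "x \<le> z" "(hull_min \<eta> x, z) \<in> \<eta>"
    using hull_minE[OF eq x] .
  \<comment> \<open>By minimality, no chord starting left of \<open>hull_min \<eta> x\<close>
    reaches \<open>x\<close>. So the chord from \<open>p\<close> to \<open>q\<close> ends strictly
    under the chord from \<open>hull_min \<eta> x\<close> to \<open>z\<close> and crosses
    it.\<close>
  have "q < x"
    using hull_min_le[of p x q \<eta>] pq z by linarith
  then show "(p, hull_min \<eta> x) \<in> \<eta>"
    using noncrossingD[OF nc _ z(3)] pq z by auto
qed

lemma admissible_hull_min:
  assumes "equiv {1..n} \<eta>" "noncrossing \<eta>"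
  shows "admissible n (hull_min \<eta>) \<eta>"
  using assms hull_min_mem hull_min_mono exposed_hull_min
  unfolding admissible_def by (auto intro!: mono_onI simp: Pi_iff simp del: atLeastAtMost_iff)

section \<open>Joins of an equivalence with a monotone image of another\<close>

lemma equiv_join_image:
  assumes "equiv A \<theta>" "equiv A \<eta>" "\<psi> \<in> A \<rightarrow> A"
  shows "equiv A (join_image \<psi> \<theta> \<eta>)"
proof (rule equivI)
  let ?R = "\<theta> \<union> map_prod \<psi> \<psi> ` \<eta>"
  have R: "?R \<subseteq> A \<times> A" "sym ?R"
    using assms equiv_memD[OF assms(1)] equiv_memD[OF assms(2)] by (fastforce simp: sym_def)+
  show "join_image \<psi> \<theta> \<eta> \<subseteq> A \<times> A"
    unfolding join_image_def using trancl_subset_Sigma[OF R(1)] .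
  show "refl_on A (join_image \<psi> \<theta> \<eta>)"
    using equiv_reflD[OF assms(1)] by (auto simp: refl_on_def join_image_def)
  show "sym (join_image \<psi> \<theta> \<eta>)" "trans (join_image \<psi> \<theta> \<eta>)"
    using R by (auto simp: join_image_def sym_trancl)
qed

lemma join_image_left: "(x, y) \<in> \<theta> \<Longrightarrow> (x, y) \<in> join_image \<psi> \<theta> \<eta>"
  by (auto simp: join_image_def)

lemma join_image_right: "(x, y) \<in> \<eta> \<Longrightarrow> (\<psi> x, \<psi> y) \<in> join_image \<psi> \<theta> \<eta>"
  by (force simp: join_image_def)

lemma join_image_least:
  assumes "trans r" "\<theta> \<subseteq> r" "\<And>x y. (x, y) \<in> \<eta> \<Longrightarrow> (\<psi> x, \<psi> y) \<in> r"
  shows "join_image \<psi> \<theta> \<eta> \<subseteq> r"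
proof -
  have "\<theta> \<union> map_prod \<psi> \<psi> ` \<eta> \<subseteq> r" using assms by auto
  then show ?thesis
    unfolding join_image_def by (metis assms(1) trancl_id trancl_mono_subset)
qed

text \<open>Both sides are the transitive closure of \<open>\<zeta>\<close>, the
  \<open>\<xi>\<close>-image of \<open>\<theta>\<close> and the
  \<open>\<xi> \<circ> \<psi>\<close>-image of \<open>\<eta>\<close>. This gives associativity of
  the product.\<close>

lemma join_image_assoc:
  "join_image \<xi> \<zeta> (join_image \<psi> \<theta> \<eta>) = join_image (\<xi> \<circ> \<psi>) (join_image \<xi> \<zeta> \<theta>) \<eta>"
proof
  let ?L = "join_image \<xi> \<zeta> (join_image \<psi> \<theta> \<eta>)" and ?R = "join_image (\<xi> \<circ> \<psi>) (join_image \<xi> \<zeta> \<theta>) \<eta>"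
  have tr: "trans ?R" "trans ?L" by (simp_all add: join_image_def)
  have "join_image \<psi> \<theta> \<eta> \<subseteq> {(x, y). (\<xi> x, \<xi> y) \<in> ?R}"
    using join_image_right[of _ _ \<eta> "\<xi> \<circ> \<psi>"]
    by (intro join_image_least) (use tr in \<open>auto simp: trans_def intro: join_image_left join_image_right\<close>)
  then show "?L \<subseteq> ?R"
    by (intro join_image_least[OF tr(1)]) (auto intro: join_image_left)
  show "?R \<subseteq> ?L"
    by (intro join_image_least[OF tr(2)] subrelI)
      (auto intro: join_image_left join_image_right)
qed

text \<open>The use of \<open>min\<close> and \<open>max\<close> allows the ends of a chord to be
  given in either order.\<close>

definition inside :: "nat \<Rightarrow> nat \<Rightarrow> nat \<Rightarrow> bool" where
  "inside q s t \<longleftrightarrow> min q s < t \<and> t < max q s"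

lemma trancl_exit:
  assumes "(x, y) \<in> R\<^sup>+" "P x" "\<not> P y"
  obtains u v where "(x, u) \<in> R\<^sup>*" "(u, v) \<in> R" "P u" "\<not> P v" "(v, y) \<in> R\<^sup>*"
proof -
  have "(x, y) \<in> R\<^sup>*" using assms(1) by simp
  then have "\<exists>u v. (x, u) \<in> R\<^sup>* \<and> (u, v) \<in> R \<and> P u \<and> \<not> P v \<and> (v, y) \<in> R\<^sup>*"
    using assms(3)
  proof (induction rule: rtrancl_induct)
    case base then show ?case using assms(2) by simp
  next
    case (step y z) then show ?case by (meson rtrancl.simps)
  qed
  then show ?thesis using that by blast
qed

text \<open>A path between points on different sides of a chord must use an edge crossing that chord or
  one of its endpoints; this is applied first to a path and an edge, then to two paths.\<close>

lemma noncrossing_trancl: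
  assumes sym: "sym R"
    and R: "\<And>p q r s. p < q \<Longrightarrow> q < r \<Longrightarrow> r < s \<Longrightarrow> (p, r) \<in> R \<Longrightarrow> (q, s) \<in> R \<Longrightarrow> (p, q) \<in> R\<^sup>+"
  shows "noncrossing (R\<^sup>+)"
proof -
  have tsym: "(y, x) \<in> R\<^sup>+" if "(x, y) \<in> R\<^sup>+" for x y
    using sym_trancl[OF sym] that by (meson symD)
  have edges: "(u, q) \<in> R\<^sup>+"
    if uv: "(u, v) \<in> R" "(q, s) \<in> R" and "inside q s u \<noteq> inside q s v" "u \<notin> {q, s}" "v \<notin> {q, s}" for u v q s
  proof -
    have uv': "(v, u) \<in> R" "(s, q) \<in> R" using uv sym by (meson symD)+
    \<comment> \<open>Once sorted, the two edges interleave, but either of them may have the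
      leftmost end; hence two instances.\<close>
    note t = R[of "min u v" "min q s" "max u v" "max q s"] R[of "min q s" "min u v" "max q s" "max u v"]
    have "(min u v, min q s) \<in> R\<^sup>+ \<or> (min q s, min u v) \<in> R\<^sup>+"
      using t that uv' unfolding inside_def by (auto simp: min_def max_def split: if_splits)
    moreover have "(u, min u v) \<in> R\<^sup>*" "(min q s, q) \<in> R\<^sup>*"
      using uv uv' by (auto simp: min_def)
    ultimately show ?thesis
      by (meson rtrancl_trancl_trancl tsym trancl_rtrancl_trancl)
  qed
  have path_edge: "(x, q) \<in> R\<^sup>+"
    if xz: "(x, z) \<in> R\<^sup>+" and qs: "(q, s) \<in> R" and *: "inside q s x \<noteq> inside q s z" "x \<notin> {q, s}" for x z q s
  proof -
    have qs': "(s, q) \<in> R" using qs sym by (meson symD)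
    \<comment> \<open>The points off the chord's ends and on the same side as \<open>x\<close>. An
      edge leaving this set either hits an end of the chord or crosses the chord.\<close>
    define P where "P t \<longleftrightarrow> inside q s t = inside q s x \<and> t \<notin> {q, s}" for t
    obtain u v where uv: "(x, u) \<in> R\<^sup>*" "(u, v) \<in> R" "P u" "\<not> P v"
      using trancl_exit[OF xz, of P] * unfolding P_def by blast
    have "(u, q) \<in> R\<^sup>+"
    proof (cases "v \<in> {q, s}")
      case True then show ?thesis using uv qs' by (auto intro: trancl_into_trancl)
    next
      case False then show ?thesis using edges[OF uv(2) qs] uv unfolding P_def by auto
    qed
    then show ?thesis using uv(1) by simp
  qed
  have "(x, y) \<in> R\<^sup>+" if "x < y" "y < z" "z < w" and xz: "(x, z) \<in> R\<^sup>+" and yw: "(y, w) \<in> R\<^sup>+" for x y z w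
  proof -
    \<comment> \<open>The path from \<open>y\<close> to \<open>w\<close> leaves the open interval
      between \<open>x\<close> and \<open>z\<close> along some edge from \<open>u\<close> to
      \<open>v\<close>. If \<open>v\<close> is not \<open>x\<close> or \<open>z\<close>, this edge
      separates \<open>x\<close> from \<open>z\<close>, so \<open>path_edge\<close> applies with the
      edge as the chord and the path from \<open>x\<close> to \<open>z\<close> crossing it.\<close>
    define P where "P t \<longleftrightarrow> x < t \<and> t < z" for t
    have "P y" "\<not> P w" using that by (auto simp: P_def)
    with yw obtain u v where uv: "(y, u) \<in> R\<^sup>*" "(u, v) \<in> R" "P u" "\<not> P v"
      by (rule trancl_exit)
    have vu: "(v, u) \<in> R" using uv sym by (meson symD)
    have "(x, u) \<in> R\<^sup>+"
    proof (cases "v \<in> {x, z}")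
      case True then show ?thesis using vu xz by (auto intro: trancl_into_trancl)
    next
      case False
      have "inside u v x \<noteq> inside u v z"
        using uv False unfolding inside_def P_def by auto
      then show ?thesis using path_edge[OF xz uv(2)] uv False unfolding P_def by auto
    qed
    moreover have "(u, y) \<in> R\<^sup>*"
      using uv(1) sym by (meson sym_rtrancl symD)
    ultimately show ?thesis by simp
  qed
  then show ?thesis unfolding noncrossing_def by blast
qed

text \<open>It suffices to treat crossing generators. Two from \<open>\<theta>\<close> are settled
  by noncrossing of \<open>\<theta>\<close>; in a mixed pair, an end of the
  \<open>\<psi>\<close>-edge lies under the \<open>\<theta>\<close>-edge and is exposed in
  \<open>\<theta>\<close>; two from \<open>\<eta>\<close> pull back to a crossing in
  \<open>\<eta>\<close>, since a monotone map reflects strict inequalities.\<close>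

lemma noncrossing_join_image:
  assumes ad: "admissible n \<psi> \<theta>" and eq: "equiv {1..n} \<eta>" and nc: "noncrossing \<eta>"
  shows "noncrossing (join_image \<psi> \<theta> \<eta>)"
proof -
  have th: "equiv {1..n} \<theta>" "noncrossing \<theta>" and mono: "mono_on {1..n} \<psi>"
    and ex: "\<And>u. u \<in> {1..n} \<Longrightarrow> exposed \<theta> (\<psi> u)"
    using ad unfolding admissible_def by auto
  let ?R = "\<theta> \<union> map_prod \<psi> \<psi> ` \<eta>"
  have "sym ?R"
    using equiv_memD(3)[OF th(1)] equiv_memD(3)[OF eq] by (fastforce simp: sym_def)
  moreover have "(p, q) \<in> ?R\<^sup>+" if l: "p < q" "q < r" "r < s" and pr: "(p, r) \<in> ?R" and qs: "(q, s) \<in> ?R" for p q r s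
  proof (cases "(p, r) \<in> \<theta>")
    case T: True
    show ?thesis
    proof (cases "(q, s) \<in> \<theta>")
      case True then show ?thesis using noncrossingD[OF th(2) T] l by blast
    next
      case False
      then obtain q' where "q' \<in> {1..n}" "q = \<psi> q'"
        using qs equiv_memD[OF eq] by auto
      then show ?thesis using exposedD[OF ex T] l by auto
    qed
  next
    case False
    then obtain p' r' where p': "(p', r') \<in> \<eta>" "p = \<psi> p'" "r = \<psi> r'"
      using pr by auto
    show ?thesis
    proof (cases "(q, s) \<in> \<theta>")
      case True
      have "(q, r) \<in> \<theta>"
        using exposedD[OF ex True] p' equiv_memD[OF eq p'(1)] l by auto
      then have "(r, q) \<in> \<theta>" using equiv_memD(3)[OF th(1)] by blast
      then show ?thesis using pr by (meson UnCI r_into_trancl trancl_into_trancl)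
    next
      case False
      then obtain q' s' where q': "(q', s') \<in> \<eta>" "q = \<psi> q'" "s = \<psi> s'"
        using qs by auto
      have *: "x < y" if "\<psi> x < \<psi> y" "x \<in> {1..n}" "y \<in> {1..n}" for x y
        using mono_onD[OF mono that(3,2)] that(1) by linarith
      have "(p', q') \<in> \<eta>"
        using noncrossingD[OF nc p'(1) q'(1)] * l p' q' equiv_memD[OF eq p'(1)] equiv_memD[OF eq q'(1)]
        by blast
      then show ?thesis using p' q' by force
    qed
  qed
  ultimately show ?thesis
    unfolding join_image_def by (rule noncrossing_trancl)
qed

text \<open>A chain of generators from \<open>p\<close> to \<open>q\<close> must hit
  \<open>\<psi> x\<close> or jump over it. The jumping edge is tied to \<open>\<psi> x\<close> by
  exposure in \<open>\<theta>\<close>, or, after pulling back along \<open>\<psi>\<close>, by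
  exposure of \<open>x\<close> in \<open>\<eta>\<close>.\<close>

lemma exposed_join_image:
  assumes ad: "admissible n \<psi> \<theta>" and eq: "equiv {1..n} \<eta>" and x: "x \<in> {1..n}" and ex: "exposed \<eta> x"
  shows "exposed (join_image \<psi> \<theta> \<eta>) (\<psi> x)"
  unfolding exposed_def
proof (intro allI impI)
  fix p q assume *: "p < \<psi> x \<and> \<psi> x < q \<and> (p, q) \<in> join_image \<psi> \<theta> \<eta>"
  have th: "equiv {1..n} \<theta>" and mono: "mono_on {1..n} \<psi>"
    and ext: "exposed \<theta> (\<psi> x)"
    using ad x unfolding admissible_def by auto
  let ?R = "\<theta> \<union> map_prod \<psi> \<psi> ` \<eta>"
  have "(p, q) \<in> ?R\<^sup>+" "p < \<psi> x" "\<not> q < \<psi> x" using * by (auto simp: join_image_def)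
  then obtain u v where uv: "(p, u) \<in> ?R\<^sup>*" "(u, v) \<in> ?R" "u < \<psi> x" "\<not> v < \<psi> x"
    by (rule trancl_exit[where P = "\<lambda>t. t < \<psi> x"])
  have "(u, \<psi> x) \<in> ?R\<^sup>+"
  proof (cases "v = \<psi> x")
    case True then show ?thesis using uv(2) by (simp only: trancl.r_into_trancl)
  next
    case v: False
    show ?thesis
    proof (cases "(u, v) \<in> \<theta>")
      case True then show ?thesis using exposedD[OF ext True] uv v by auto
    next
      case False
      then obtain u' v' where u': "(u', v') \<in> \<eta>" "u = \<psi> u'" "v = \<psi> v'"
        using uv by auto
      have "u' < x" "x < v'"
        using mono_onD[OF mono x, of u'] mono_onD[OF mono _ x, of v'] uv u' v equiv_memD[OF eq u'(1)]
        by (meson leI le_neq_implies_less not_le)+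
      then have "(u', x) \<in> \<eta>" using exposedD[OF ex u'(1)] by blast
      then show ?thesis using u' by force
    qed
  qed
  then show "(p, \<psi> x) \<in> join_image \<psi> \<theta> \<eta>"
    unfolding join_image_def using uv(1) by simp
qed

lemma admissible_comp:
  assumes "admissible n \<phi> \<eta>" and "admissible n \<psi> \<theta>"
  shows "admissible n (\<psi> \<circ> \<phi>) (join_image \<psi> \<theta> \<eta>)"
proof -
  have "mono_on {1..n} (\<psi> \<circ> \<phi>)"
    using assms unfolding admissible_def mono_on_def by (auto simp: Pi_iff)
  moreover have "\<psi> \<circ> \<phi> \<in> {1..n} \<rightarrow> {1..n}"
    using assms unfolding admissible_def by auto
  ultimately show ?thesis
    using assms(1) equiv_join_image noncrossing_join_image[OF assms(2)] exposed_join_image[OF assms(2)]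
      assms(2)[unfolded admissible_def]
    unfolding admissible_def by (simp add: Pi_iff)
qed

text \<open>\<open>hull_min \<theta>\<close> is constant on \<open>\<theta>\<close>-classes, so the
  image of \<open>\<eta>\<close> lies on the diagonal and adds nothing.\<close>

lemma join_image_hull_min:
  assumes "equiv A \<theta>" "noncrossing \<theta>" "equiv A \<eta>" "\<eta> \<subseteq> \<theta>"
  shows "join_image (hull_min \<theta>) \<theta> \<eta> = \<theta>"
proof
  have "(hull_min \<theta> x, hull_min \<theta> y) \<in> \<theta>" if "(x, y) \<in> \<eta>" for x y
    using that assms hull_min_eq[OF assms(1,2)] hull_min_mem[OF assms(1)] equiv_reflD[OF assms(1)]
      equiv_memD[OF assms(3)] by (metis subsetD)
  then show "join_image (hull_min \<theta>) \<theta> \<eta> \<subseteq> \<theta>"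
    using assms(1) by (intro join_image_least) (auto simp: equiv_def)
qed (auto intro: join_image_left)

text \<open>The point \<open>hull_min \<eta> u\<close> is exposed, so its
  \<open>\<psi>\<close>-image is exposed in the join and related to its own hull minimum. By
  monotonicity \<open>\<psi> u\<close> lies under the image of the chord over \<open>u\<close>, so
  it has that same hull minimum.\<close>

lemma comp_hull_min_related:
  assumes ad: "admissible n \<psi> \<theta>" and eq: "equiv {1..n} \<eta>" and nc: "noncrossing \<eta>" and u: "u \<in> {1..n}"
  shows "(\<psi> (hull_min \<eta> u), hull_min (join_image \<psi> \<theta> \<eta>) (\<psi> u)) \<in> join_image \<psi> \<theta> \<eta>"
proof -
  let ?c = "join_image \<psi> \<theta> \<eta>" and ?x = "hull_min \<eta> u"
  have \<psi>: "\<psi> \<in> {1..n} \<rightarrow> {1..n}" and mono: "mono_on {1..n} \<psi>" and th: "equiv {1..n} \<theta>"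
    using ad unfolding admissible_def by auto
  have c: "equiv {1..n} ?c" "noncrossing ?c"
    using equiv_join_image[OF th eq \<psi>] noncrossing_join_image[OF ad eq nc] by auto
  obtain v where v: "?x \<le> u" "u \<le> v" "(?x, v) \<in> \<eta>"
    using hull_minE[OF eq u] .
  have x: "?x \<in> {1..n}" "v \<in> {1..n}" using equiv_memD[OF eq v(3)] by auto
  have "exposed ?c (\<psi> ?x)"
    using exposed_join_image[OF ad eq x(1)] exposed_hull_min[OF eq nc u] by blast
  then have 1: "(hull_min ?c (\<psi> ?x), \<psi> ?x) \<in> ?c"
    using hull_min_related[OF c(1)] \<psi> x(1) by blast
  have "hull_min ?c (\<psi> u) = hull_min ?c (\<psi> ?x)"
    by (rule hull_min_between[OF c join_image_right[OF v(3)]])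
      (use \<psi> u x v mono in \<open>auto simp: mono_on_def\<close>)
  then show ?thesis using equiv_memD(3)[OF c(1) 1] by simp
qed

section \<open>Planar drawings\<close>

lemma mem_cbox_vector_2:
  "p \<in> cbox (vector [x0, y0]) (vector [x1, y1] :: real^2) \<longleftrightarrow> x0 \<le> p $ 1 \<and> p $ 1 \<le> x1 \<and> y0 \<le> p $ 2 \<and> p $ 2 \<le> y1"
  by (auto simp: mem_box_cart forall_2)

text \<open>The use of \<open>path_component\<close> allows \<open>S\<close> and \<open>T\<close> to
  be whole drawn blocks, made of many arcs.\<close>

lemma fashoda_disjoint:
  fixes S T :: "(real^2) set"
  assumes "path_component S (vector [p, 0]) (vector [r, 0])"
    and "path_component T (vector [q, 0]) (vector [s, 0])"
    and "S \<subseteq> cbox (vector [0, 0]) b" "T \<subseteq> cbox (vector [0, 0]) b" "p < q" "q < r" "r < s"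
  shows "S \<inter> T \<noteq> {}"
proof -
  obtain f where f: "path f" "path_image f \<subseteq> S" "pathstart f = vector [p, 0]" "pathfinish f = vector [r, 0]"
    using assms(1) unfolding path_component_def by blast
  obtain g where g: "path g" "path_image g \<subseteq> T" "pathstart g = vector [q, 0]" "pathfinish g = vector [s, 0]"
    using assms(2) unfolding path_component_def by blast
  have "path_image f \<subseteq> cbox (vector [0, 0]) b" "path_image g \<subseteq> cbox (vector [0, 0]) b"
    using f(2) g(2) assms(3,4) by blast+
  then obtain z where "z \<in> path_image f" "z \<in> path_image g"
    by (rule fashoda_interlace[OF f(1) g(1)]) (simp_all add: f(3,4) g(3,4) assms(5,6,7))
  then show ?thesis using f g by blast
qed

text \<open>A detour around the box, running from the top side to the bottom side of a larger box,
  so that arcs ending on the top side can be treated by \<open>fashoda_interlace\<close> as well.\<close>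

definition right_detour :: "nat \<Rightarrow> real \<Rightarrow> (real^2) set" where
  "right_detour n v = closed_segment (vector [v, 1]) (vector [real n + 1, 2])
     \<union> closed_segment (vector [real n + 1, 2]) (vector [real n + 1, 0])"

definition left_detour :: "real \<Rightarrow> (real^2) set" where
  "left_detour v = closed_segment (vector [v, 1]) (vector [0, 2])
     \<union> closed_segment (vector [0, 2]) (vector [0, 0])"

lemma path_component_segments:
  "path_component (closed_segment x y \<union> closed_segment y z) x (z :: 'a :: real_normed_vector)"
proof (rule path_component_trans)
  have *: "path_component (closed_segment p q) p (q :: 'a)" for p q
    unfolding path_component_def
    by (rule exI[of _ "linepath p q"]) simp
  show "path_component (closed_segment x y \<union> closed_segment y z) x y"
    by (rule path_component_of_subset[OF _ *]) simp
  show "path_component (closed_segment x y \<union> closed_segment y z) y z"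
    by (rule path_component_of_subset[OF _ *]) simp
qed

lemma in_segment_vector_2:
  assumes "p \<in> closed_segment (vector [x0, y0]) (vector [x1, y1] :: real^2)"
  obtains t where "0 \<le> t" "t \<le> 1" "p $ 1 = x0 + t * (x1 - x0)" "p $ 2 = y0 + t * (y1 - y0)"
proof -
  obtain t where "0 \<le> t" "t \<le> 1" "p = (1 - t) *\<^sub>R vector [x0, y0] + t *\<^sub>R vector [x1, y1]"
    using assms unfolding in_segment by blast
  moreover from this(3) have "p $ 1 = x0 + t * (x1 - x0)" "p $ 2 = y0 + t * (y1 - y0)"
    by (simp_all add: left_diff_distrib right_diff_distrib)
  ultimately show ?thesis using that by blast
qed

text \<open>The coordinate bound keeps left and right detours apart; the last fact ensures that a
  detour meets a set inside the original box at most in its starting point.\<close>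

lemma right_detour:
  assumes v: "1 \<le> v" "v \<le> real n" and p: "p \<in> right_detour n v"
  shows "p \<in> cbox (vector [0, 0]) (vector [real n + 1, 2])" "v \<le> p $ 1"
    "p \<in> cbox (vector [1, 0]) (vector [real n, 1]) \<Longrightarrow> p = vector [v, 1]"
proof -
  \<comment> \<open>The cases are the starting point, the rest of the slanted segment, and the
    vertical segment.\<close>
  have "(p $ 1 = v \<and> p $ 2 = 1) \<or> (v < p $ 1 \<and> p $ 1 \<le> real n + 1 \<and> 1 < p $ 2 \<and> p $ 2 \<le> 2)
     \<or> (p $ 1 = real n + 1 \<and> 0 \<le> p $ 2 \<and> p $ 2 \<le> 2)"
    using p unfolding right_detour_def
  proof
    assume "p \<in> closed_segment (vector [v, 1]) (vector [real n + 1, 2])"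
    then obtain t where t: "0 \<le> t" "t \<le> 1" "p $ 1 = v + t * (real n + 1 - v)" "p $ 2 = 1 + t * (2 - 1)"
      by (rule in_segment_vector_2)
    moreover have "t * (real n + 1 - v) \<le> 1 * (real n + 1 - v)"
      using t v by (intro mult_right_mono) auto
    moreover have "t = 0 \<or> 0 < t * (real n + 1 - v)"
      using t v by (auto intro!: mult_pos_pos)
    ultimately show ?thesis by auto
  next
    assume "p \<in> closed_segment (vector [real n + 1, 2]) (vector [real n + 1, 0])"
    then show ?thesis by (rule in_segment_vector_2) simp
  qed
  then show "p \<in> cbox (vector [0, 0]) (vector [real n + 1, 2])" "v \<le> p $ 1"
    "p \<in> cbox (vector [1, 0]) (vector [real n, 1]) \<Longrightarrow> p = vector [v, 1]"
    using v by (auto simp: mem_cbox_vector_2 vec_eq_iff forall_2)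
qed

lemma left_detour:
  assumes v: "1 \<le> v" "v \<le> real n" and p: "p \<in> left_detour v"
  shows "p \<in> cbox (vector [0, 0]) (vector [real n + 1, 2])" "p $ 1 \<le> v"
    "p \<in> cbox (vector [1, 0]) (vector [real n, 1]) \<Longrightarrow> p = vector [v, 1]"
proof -
  have "(p $ 1 = v \<and> p $ 2 = 1) \<or> (0 \<le> p $ 1 \<and> p $ 1 < v \<and> 1 < p $ 2 \<and> p $ 2 \<le> 2)
     \<or> (p $ 1 = 0 \<and> 0 \<le> p $ 2 \<and> p $ 2 \<le> 2)"
    using p unfolding left_detour_def
  proof
    assume "p \<in> closed_segment (vector [v, 1]) (vector [0, 2])"
    then obtain t where t: "0 \<le> t" "t \<le> 1" "p $ 1 = v + t * (0 - v)" "p $ 2 = 1 + t * (2 - 1)"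
      by (rule in_segment_vector_2)
    moreover have "t * v \<le> 1 * v"
      using t v by (intro mult_right_mono) auto
    moreover have "t = 0 \<or> 0 < t * v"
      using t v by (auto intro!: mult_pos_pos)
    ultimately show ?thesis by auto
  next
    assume "p \<in> closed_segment (vector [0, 2]) (vector [0, 0])"
    then show ?thesis by (rule in_segment_vector_2) simp
  qed
  then show "p \<in> cbox (vector [0, 0]) (vector [real n + 1, 2])" "p $ 1 \<le> v"
    "p \<in> cbox (vector [1, 0]) (vector [real n, 1]) \<Longrightarrow> p = vector [v, 1]"
    using v by (auto simp: mem_cbox_vector_2 vec_eq_iff forall_2)
qed

lemma path_component_right_detour:
  assumes "path_component S x (vector [v, 1])"
  shows "path_component (S \<union> right_detour n v) x (vector [real n + 1, 0])"
  by (rule path_component_trans[OF path_component_of_subset[OF _ assms]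
        path_component_of_subset[OF _ path_component_segments]]) (auto simp: right_detour_def)

lemma path_component_left_detour:
  assumes "path_component S x (vector [v, 1])"
  shows "path_component (S \<union> left_detour v) (vector [0, 0]) x"
  by (rule path_component_sym,
      rule path_component_trans[OF path_component_of_subset[OF _ assms]
        path_component_of_subset[OF _ path_component_segments]]) (auto simp: left_detour_def)

text \<open>Prolonging \<open>T\<close> by a right detour turns the top end \<open>v\<close> into
  the bottom end \<open>n + 1\<close>, so that \<open>x < y < z < n + 1\<close> interlace. The
  detour can meet \<open>S\<close> only in its starting point, which belongs to
  \<open>T\<close>.\<close>

lemma crossing_bottom_top:
  fixes S T :: "(real^2) set"
  assumes S: "S \<subseteq> cbox (vector [1, 0]) (vector [real n, 1])" and T: "T \<subseteq> cbox (vector [1, 0]) (vector [real n, 1])"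
    and xz: "path_component S (vector [x, 0]) (vector [z, 0])"
    and yv: "path_component T (vector [y, 0]) (vector [v, 1])"
    and "x < y" "y < z"
  shows "S \<inter> T \<noteq> {}"
proof -
  have m: "vector [v, 1] \<in> T" "vector [z, 0] \<in> S"
    using path_component_mem[OF yv] path_component_mem[OF xz] by auto
  have v: "1 \<le> v" "v \<le> real n" and z: "z \<le> real n"
    using subsetD[OF T m(1)] subsetD[OF S m(2)] by (auto simp: mem_cbox_vector_2)
  have "S \<inter> (T \<union> right_detour n v) \<noteq> {}"
  proof (rule fashoda_disjoint[OF xz path_component_right_detour[OF yv]])
    show "S \<subseteq> cbox (vector [0, 0]) (vector [real n + 1, 2])"
      using S by (force simp: mem_cbox_vector_2)
    show "T \<union> right_detour n v \<subseteq> cbox (vector [0, 0]) (vector [real n + 1, 2])"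
      using T right_detour(1)[OF v] by (force simp: mem_cbox_vector_2)
  qed (use assms z in auto)
  then show ?thesis
    using right_detour(3)[OF v] S m by blast
qed

text \<open>With a left detour attached to \<open>S\<close> and a right one to \<open>T\<close>, the
  bottom ends satisfy \<open>0 < y < x < n + 1\<close> and interlace. The detours are disjoint
  because \<open>u < v\<close>, and each meets the original box only in its starting point.\<close>

lemma crossing_bottom_top_pair:
  fixes S T :: "(real^2) set"
  assumes S: "S \<subseteq> cbox (vector [1, 0]) (vector [real n, 1])" and T: "T \<subseteq> cbox (vector [1, 0]) (vector [real n, 1])"
    and xu: "path_component S (vector [x, 0]) (vector [u, 1])"
    and yv: "path_component T (vector [y, 0]) (vector [v, 1])"
    and "u < v" "y < x"
  shows "S \<inter> T \<noteq> {}"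
proof -
  have m: "vector [v, 1] \<in> T" "vector [u, 1] \<in> S" "vector [x, 0] \<in> S" "vector [y, 0] \<in> T"
    using path_component_mem[OF yv] path_component_mem[OF xu] by auto
  have v: "1 \<le> v" "v \<le> real n" and u: "1 \<le> u" "u \<le> real n" and xy: "1 \<le> y" "x \<le> real n"
    using subsetD[OF T m(1)] subsetD[OF S m(2)] subsetD[OF T m(4)] subsetD[OF S m(3)]
    by (auto simp: mem_cbox_vector_2)
  have "(S \<union> left_detour u) \<inter> (T \<union> right_detour n v) \<noteq> {}"
  proof (rule fashoda_disjoint[OF path_component_left_detour[OF xu] path_component_right_detour[OF yv]])
    show "S \<union> left_detour u \<subseteq> cbox (vector [0, 0]) (vector [real n + 1, 2])"
      using S left_detour(1)[OF u] by (force simp: mem_cbox_vector_2)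
    show "T \<union> right_detour n v \<subseteq> cbox (vector [0, 0]) (vector [real n + 1, 2])"
      using T right_detour(1)[OF v] by (force simp: mem_cbox_vector_2)
  qed (use assms xy in auto)
  moreover have "left_detour u \<inter> right_detour n v = {}"
    using left_detour(2)[OF u] right_detour(2)[OF v] \<open>u < v\<close> by fastforce
  ultimately show ?thesis
    using right_detour(3)[OF v] left_detour(3)[OF u] S T m by blast
qed

section \<open>Blocks as disjoint connected sets of the drawing\<close>

definition block_image :: "vertex set set \<Rightarrow> (vertex set \<Rightarrow> real \<Rightarrow> real^2) \<Rightarrow> vertex set \<Rightarrow> (real^2) set" where
  "block_image E \<gamma> B = pos ` B \<union> (\<Union>e\<in>{e\<in>E. e \<subseteq> B}. path_image (\<gamma> e))"

lemma inj_on_pos: "inj_on pos (vertices n)"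
  by (auto simp: inj_on_def vertices_def vec_eq_iff forall_2)

lemma planar_drawingD:
  assumes "planar_drawing n E \<gamma>" "e \<in> E"
  shows "path (\<gamma> e)" "{pathstart (\<gamma> e), pathfinish (\<gamma> e)} = pos ` e"
    "path_image (\<gamma> e) \<subseteq> cbox (vector [1, 0]) (vector [real n, 1])"
    "path_image (\<gamma> e) \<inter> pos ` vertices n \<subseteq> pos ` e"
  using assms by (simp_all add: planar_drawing_def arc_imp_path)

lemma planar_drawing_disjoint:
  assumes "planar_drawing n E \<gamma>" "e \<in> E" "f \<in> E" "e \<noteq> f"
  shows "path_image (\<gamma> e) \<inter> path_image (\<gamma> f) \<subseteq> pos ` (e \<inter> f)"
  using assms by (simp add: planar_drawing_def)

lemma block_image_disjoint:
  assumes dr: "planar_drawing n E \<gamma>" and BC: "B \<subseteq> vertices n" "C \<subseteq> vertices n" "B \<inter> C = {}"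
  shows "block_image E \<gamma> B \<inter> block_image E \<gamma> C = {}"
proof -
  have vv: "pos ` B \<inter> pos ` C = {}"
    using inj_on_image_Int[OF inj_on_pos BC(1,2)] BC(3) by simp
  have ve: "pos ` D \<inter> path_image (\<gamma> f) \<subseteq> pos ` D \<inter> pos ` D'"
    if "f \<in> E" "f \<subseteq> D'" "D \<subseteq> vertices n" for f D D'
    using planar_drawingD(4)[OF dr that(1)] image_mono[OF that(2), of pos] image_mono[OF that(3), of pos]
    by blast
  have ee: "path_image (\<gamma> e) \<inter> path_image (\<gamma> f) = {}"
    if "e \<in> E" "f \<in> E" "e \<subseteq> B" "f \<subseteq> C" for e f
  proof -
    have "e \<inter> f = {}" using that BC(3) by blast
    \<comment> \<open>Disjoint edges could coincide only if both were empty, but an arc has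
      endpoints.\<close>
    moreover have "e \<noteq> {}" using planar_drawingD(2)[OF dr that(1)] by auto
    ultimately have "e \<noteq> f" by blast
    from planar_drawing_disjoint[OF dr that(1,2) this] show ?thesis
      using \<open>e \<inter> f = {}\<close> by simp
  qed
  show ?thesis
  proof (rule equals0I)
    fix z assume "z \<in> block_image E \<gamma> B \<inter> block_image E \<gamma> C"
    then have "z \<in> block_image E \<gamma> B" "z \<in> block_image E \<gamma> C" by simp_all
    then consider "z \<in> pos ` B" "z \<in> pos ` C"
      | f where "z \<in> pos ` B" "f \<in> E" "f \<subseteq> C" "z \<in> path_image (\<gamma> f)"
      | e where "z \<in> pos ` C" "e \<in> E" "e \<subseteq> B" "z \<in> path_image (\<gamma> e)"
      | e f where "e \<in> E" "e \<subseteq> B" "z \<in> path_image (\<gamma> e)" "f \<in> E" "f \<subseteq> C" "z \<in> path_image (\<gamma> f)"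
      unfolding block_image_def by blast
    then show False
    proof cases
      case 1 then show ?thesis using vv by blast
    next
      case 2 then show ?thesis using ve[OF 2(2,3) BC(1)] vv by blast
    next
      case 3 then show ?thesis using ve[OF 3(2,3) BC(2)] vv by blast
    next
      case 4 then show ?thesis using ee[OF 4(1,4,2,5)] by blast
    qed
  qed
qed

lemma pos_in_box: "v \<in> vertices n \<Longrightarrow> pos v \<in> cbox (vector [1, 0]) (vector [real n, 1])"
  by (auto simp: vertices_def mem_cbox_vector_2)

lemma block_image_box:
  assumes dr: "planar_drawing n E \<gamma>" and B: "B \<subseteq> vertices n"
  shows "block_image E \<gamma> B \<subseteq> cbox (vector [1, 0]) (vector [real n, 1])"
proof -
  have "pos ` B \<subseteq> cbox (vector [1, 0]) (vector [real n, 1])"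
    using B pos_in_box by blast
  then show ?thesis
    using planar_drawingD(3)[OF dr] by (simp add: block_image_def UN_subset_iff)
qed

text \<open>All edges on a graph path from a representative \<open>w\<close> stay inside the
  component \<open>B\<close>, so their arcs belong to the image of \<open>B\<close> and can be
  concatenated.\<close>

lemma block_image_path_component:
  assumes dr: "planar_drawing n E \<gamma>" and E: "E \<subseteq> {{u, v} | u v. u \<in> vertices n \<and> v \<in> vertices n \<and> u \<noteq> v}"
    and B: "B \<in> graph_components (vertices n) E" and uv: "u \<in> B" "v \<in> B"
  shows "path_component (block_image E \<gamma> B) (pos u) (pos v)"
proof -
  let ?R = "{(x, y). {x, y} \<in> E}"
  obtain w where w: "w \<in> vertices n" "B = {v \<in> vertices n. (w, v) \<in> ?R\<^sup>*}"
    using B unfolding graph_components_def quotient_def by auto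
  have "path_component (block_image E \<gamma> B) (pos w) (pos v)" if "(w, v) \<in> ?R\<^sup>*" for v
    using that
  proof (induction rule: rtrancl_induct)
    case base
    show ?case using w by (auto simp: block_image_def intro!: path_component_refl)
  next
    case (step y z)
    then have yz: "{y, z} \<in> E" by simp
    then have "y \<in> vertices n" "z \<in> vertices n" using E by (auto simp: doubleton_eq_iff)
    moreover have "(w, z) \<in> ?R\<^sup>*" using step.hyps by (rule rtrancl_into_rtrancl)
    ultimately have sub: "path_image (\<gamma> {y, z}) \<subseteq> block_image E \<gamma> B"
      using w step.hyps(1) yz unfolding block_image_def by blast
    have arc: "path (\<gamma> {y, z})" "{pathstart (\<gamma> {y, z}), pathfinish (\<gamma> {y, z})} = {pos y, pos z}"
      using planar_drawingD(1,2)[OF dr yz] by simp_all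
    have "path_component (block_image E \<gamma> B) (pathstart (\<gamma> {y, z})) (pathfinish (\<gamma> {y, z}))"
      using arc(1) sub unfolding path_component_def by blast
    then have "path_component (block_image E \<gamma> B) (pos y) (pos z)"
      using arc(2) by (auto simp: doubleton_eq_iff intro: path_component_sym)
    with step.IH show ?case by (rule path_component_trans)
  qed
  then show ?thesis using uv w path_component_sym path_component_trans by blast
qed

text \<open>Distinct blocks have disjoint connected images, which each of the three patterns
  contradicts. The patterns will give, in this order, noncrossing of the cokernel, exposure of the
  values of \<open>\<phi>\<close>, and monotonicity of \<open>\<phi>\<close>.\<close>

lemma planar_partition_crossing:
  assumes pl: "planar_partition n a" and p: "a \<in> partitions n" and BC: "B \<in> a" "C \<in> a"
  shows "\<lbrakk>Low x \<in> B; Low z \<in> B; Low y \<in> C; Low w \<in> C; x < y; y < z; z < w\<rbrakk> \<Longrightarrow> B = C"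
    and "\<lbrakk>Low x \<in> B; Low z \<in> B; Low y \<in> C; Up v \<in> C; x < y; y < z\<rbrakk> \<Longrightarrow> B = C"
    and "\<lbrakk>Low x \<in> B; Up u \<in> B; Low y \<in> C; Up v \<in> C; u < v; y < x\<rbrakk> \<Longrightarrow> B = C"
proof -
  obtain E \<gamma> where E: "E \<subseteq> {{u, v} | u v. u \<in> vertices n \<and> v \<in> vertices n \<and> u \<noteq> v}"
    and a: "graph_components (vertices n) E = a" and dr: "planar_drawing n E \<gamma>"
    using pl unfolding planar_partition_def by blast
  have sub: "B \<subseteq> vertices n" "C \<subseteq> vertices n"
    using p BC unfolding partitions_def partition_on_def by auto
  have disj: "B = C" if "block_image E \<gamma> B \<inter> block_image E \<gamma> C \<noteq> {}"
    using block_image_disjoint[OF dr sub] that p BC unfolding partitions_def partition_on_def disjoint_def by blast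
  note S = block_image_box[OF dr sub(1)] and T = block_image_box[OF dr sub(2)]
  note pB = block_image_path_component[OF dr E BC(1)[folded a]]
  note pC = block_image_path_component[OF dr E BC(2)[folded a]]
  show "B = C" if "Low x \<in> B" "Low z \<in> B" "Low y \<in> C" "Low w \<in> C" "x < y" "y < z" "z < w"
    using that pB[of "Low x" "Low z"] pC[of "Low y" "Low w"] S T
    by (intro disj fashoda_disjoint[of _ "real x" "real z" _ "real y" "real w" "vector [real n, 1]"])
      (auto simp: subset_iff mem_cbox_vector_2)
  show "B = C" if "Low x \<in> B" "Low z \<in> B" "Low y \<in> C" "Up v \<in> C" "x < y" "y < z"
    using that pB[of "Low x" "Low z"] pC[of "Low y" "Up v"]
    by (intro disj crossing_bottom_top[OF S T, of "real x" "real z" "real y" "real v"]) auto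
  show "B = C" if "Low x \<in> B" "Up u \<in> B" "Low y \<in> C" "Up v \<in> C" "u < v" "y < x"
    using that pB[of "Low x" "Up u"] pC[of "Low y" "Up v"]
    by (intro disj crossing_bottom_top_pair[OF S T, of "real x" "real u" "real y" "real v"]) auto
qed

section \<open>Full-domain partitions\<close>

text \<open>\<open>fd_part n \<phi> \<eta>\<close> is the partition with cokernel \<open>\<eta>\<close> that attaches the upper vertex \<open>u\<close>
  to the block of the lower vertex \<open>\<phi> u\<close>. The equation for \<open>Mid\<close> is junk.\<close>

fun lower :: "(nat \<Rightarrow> nat) \<Rightarrow> vertex \<Rightarrow> nat" where
  "lower \<phi> (Up u) = \<phi> u"
| "lower \<phi> (Mid x) = x"
| "lower \<phi> (Low x) = x"

definition fd_rel :: "nat \<Rightarrow> (nat \<Rightarrow> nat) \<Rightarrow> nat rel \<Rightarrow> vertex rel" where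
  "fd_rel n \<phi> \<eta> = {(u, v) \<in> vertices n \<times> vertices n. (lower \<phi> u, lower \<phi> v) \<in> \<eta>}"

definition fd_part :: "nat \<Rightarrow> (nat \<Rightarrow> nat) \<Rightarrow> nat rel \<Rightarrow> partition" where
  "fd_part n \<phi> \<eta> = vertices n // fd_rel n \<phi> \<eta>"

lemma Up_in_vertices [simp]: "Up x \<in> vertices n \<longleftrightarrow> x \<in> {1..n}"
  and Low_in_vertices [simp]: "Low x \<in> vertices n \<longleftrightarrow> x \<in> {1..n}"
  and Mid_notin_vertices [simp]: "Mid x \<notin> vertices n"
  by (auto simp: vertices_def)

lemma lower_mem: "\<phi> \<in> {1..n} \<rightarrow> {1..n} \<Longrightarrow> v \<in> vertices n \<Longrightarrow> lower \<phi> v \<in> {1..n}"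
  by (cases v) auto

lemma equiv_related_cong:
  assumes eq: "equiv A \<eta>" and x: "(x, x') \<in> \<eta>" and y: "(y, y') \<in> \<eta>"
  shows "(x, y) \<in> \<eta> \<longleftrightarrow> (x', y') \<in> \<eta>"
proof
  show "(x', y') \<in> \<eta>" if "(x, y) \<in> \<eta>"
    using equiv_transD[OF eq equiv_transD[OF eq equiv_memD(3)[OF eq x] that] y] .
  show "(x, y) \<in> \<eta>" if "(x', y') \<in> \<eta>"
    using equiv_transD[OF eq equiv_transD[OF eq x that] equiv_memD(3)[OF eq y]] .
qed

lemma equiv_pullback:
  assumes eq: "equiv A \<eta>" and f: "\<And>v. v \<in> W \<Longrightarrow> f v \<in> A"
  shows "equiv W {(u, v) \<in> W \<times> W. (f u, f v) \<in> \<eta>}" (is "equiv W ?r")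
proof (rule equivI)
  show "refl_on W ?r" using equiv_reflD[OF eq f] by (auto intro!: refl_onI)
  show "sym ?r" using equiv_memD(3)[OF eq] by (auto intro!: symI)
  show "trans ?r" using equiv_transD[OF eq] by (auto intro!: transI)
qed auto

lemma equiv_fd_rel:
  assumes "equiv {1..n} \<eta>" "\<phi> \<in> {1..n} \<rightarrow> {1..n}"
  shows "equiv (vertices n) (fd_rel n \<phi> \<eta>)"
  unfolding fd_rel_def by (rule equiv_pullback[OF assms(1)]) (rule lower_mem[OF assms(2)])

lemma same_class_iff:
  assumes "equiv A r"
  shows "(\<exists>B\<in>A // r. x \<in> B \<and> y \<in> B) \<longleftrightarrow> (x, y) \<in> r"
proof
  show "\<exists>B\<in>A // r. x \<in> B \<and> y \<in> B" if xy: "(x, y) \<in> r"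
    using equiv_memD(1)[OF assms xy] equiv_reflD[OF assms] xy
    by (intro bexI[of _ "r `` {x}"]) (auto intro: quotientI)
qed (use quotient_eq_iff[OF assms] in blast)

lemma coker_fd_part:
  assumes "equiv {1..n} \<eta>" "\<phi> \<in> {1..n} \<rightarrow> {1..n}"
  shows "coker n (fd_part n \<phi> \<eta>) = \<eta>"
proof -
  have "coker n (fd_part n \<phi> \<eta>) = {(x, y) \<in> {1..n} \<times> {1..n}. (Low x, Low y) \<in> fd_rel n \<phi> \<eta>}"
    unfolding coker_def fd_part_def same_class_iff[OF equiv_fd_rel[OF assms]] ..
  also have "\<dots> = \<eta>"
    using equiv_memD(1,2)[OF assms(1)] by (auto simp: fd_rel_def simp del: atLeastAtMost_iff)
  finally show ?thesis .
qed

lemma fd_part_cong: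
  assumes eq: "equiv {1..n} \<eta>" and "\<And>u. u \<in> {1..n} \<Longrightarrow> (\<phi> u, \<phi>' u) \<in> \<eta>"
  shows "fd_part n \<phi> \<eta> = fd_part n \<phi>' \<eta>"
proof -
  have low: "(lower \<phi> v, lower \<phi>' v) \<in> \<eta>" if "v \<in> vertices n" for v
    using that assms(2) equiv_reflD[OF eq] by (cases v) auto
  have "(lower \<phi> u, lower \<phi> v) \<in> \<eta> \<longleftrightarrow> (lower \<phi>' u, lower \<phi>' v) \<in> \<eta>"
    if "u \<in> vertices n" "v \<in> vertices n" for u v
    by (rule equiv_related_cong[OF eq low[OF that(1)] low[OF that(2)]])
  then have "fd_rel n \<phi> \<eta> = fd_rel n \<phi>' \<eta>"
    unfolding fd_rel_def by auto
  then show ?thesis by (simp add: fd_part_def)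
qed

text \<open>This turns the condition on blocks in \<open>prod_rel\<close> into one on related
  pairs.\<close>

lemma image_blocks_subset_iff:
  assumes "equiv A r"
  shows "(\<forall>B\<in>(\<lambda>B. f ` B) ` (A // r). B \<times> B \<subseteq> s) \<longleftrightarrow> (\<forall>(x, y)\<in>r. (f x, f y) \<in> s)"
proof -
  have "f ` B \<times> f ` B \<subseteq> s \<longleftrightarrow> (\<forall>x\<in>B. \<forall>y\<in>B. (f x, f y) \<in> s)" for B
    by auto
  then have "(\<forall>B\<in>(\<lambda>B. f ` B) ` (A // r). B \<times> B \<subseteq> s)
    \<longleftrightarrow> (\<forall>B\<in>A // r. \<forall>x\<in>B. \<forall>y\<in>B. (f x, f y) \<in> s)"
    by simp
  also have "\<dots> \<longleftrightarrow> (\<forall>x y. (\<exists>B\<in>A // r. x \<in> B \<and> y \<in> B) \<longrightarrow> (f x, f y) \<in> s)"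
    by blast
  also have "\<dots> \<longleftrightarrow> (\<forall>(x, y)\<in>r. (f x, f y) \<in> s)"
    unfolding same_class_iff[OF assms] by auto
  finally show ?thesis .
qed

lemma part_mult_fd_part:
  assumes \<eta>: "equiv {1..n} \<eta>" and \<phi>: "\<phi> \<in> {1..n} \<rightarrow> {1..n}"
    and \<theta>: "equiv {1..n} \<theta>" and \<psi>: "\<psi> \<in> {1..n} \<rightarrow> {1..n}"
  shows "fd_part n \<phi> \<eta> \<odot>\<^bsub>n\<^esub> fd_part n \<psi> \<theta> = fd_part n (\<psi> \<circ> \<phi>) (join_image \<psi> \<theta> \<eta>)"
proof -
  define W where "W = Up ` {1..n} \<union> Mid ` {1..n} \<union> Low ` {1..n}"
  define c where "c = join_image \<psi> \<theta> \<eta>"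
  \<comment> \<open>\<open>h v\<close> is the lower vertex to which \<open>v\<close> is carried by
    following \<open>\<phi>\<close> and \<open>\<psi>\<close> downwards.\<close>
  define h where "h v = (case v of Up u \<Rightarrow> \<psi> (\<phi> u) | Mid x \<Rightarrow> \<psi> x | Low x \<Rightarrow> x)" for v
  have c: "equiv {1..n} c" unfolding c_def by (rule equiv_join_image[OF \<theta> \<eta> \<psi>])
  have h: "h v \<in> {1..n}" if "v \<in> W" for v
    using that \<phi> \<psi> by (auto simp: W_def h_def Pi_iff)
  \<comment> \<open>The candidate for the smallest equivalence: vertices are related iff their lower
    ends are \<open>c\<close>-related.\<close>
  define K where "K = {(u, v) \<in> W \<times> W. (h u, h v) \<in> c}"
  have prod: "prod_rel n (fd_part n \<phi> \<eta>) (fd_part n \<psi> \<theta>)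
    = \<Inter>{r. equiv W r \<and> (\<forall>(u, v)\<in>fd_rel n \<phi> \<eta>. (low_to_mid u, low_to_mid v) \<in> r)
        \<and> (\<forall>(u, v)\<in>fd_rel n \<psi> \<theta>. (up_to_mid u, up_to_mid v) \<in> r)}"
    unfolding prod_rel_def down_def up_def fd_part_def ball_Un W_def
      image_blocks_subset_iff[OF equiv_fd_rel[OF \<eta> \<phi>]] image_blocks_subset_iff[OF equiv_fd_rel[OF \<theta> \<psi>]] ..
  have "prod_rel n (fd_part n \<phi> \<eta>) (fd_part n \<psi> \<theta>) = K"
    unfolding prod
  proof (intro subset_antisym Inter_lower Inter_greatest CollectI conjI)
    show "equiv W K"
      unfolding K_def using c h by (rule equiv_pullback)
    have "low_to_mid v \<in> W \<and> h (low_to_mid v) = \<psi> (lower \<phi> v)" if "v \<in> vertices n" for v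
      using that by (cases v) (auto simp: W_def h_def)
    then show "\<forall>(u, v)\<in>fd_rel n \<phi> \<eta>. (low_to_mid u, low_to_mid v) \<in> K"
      by (auto simp: fd_rel_def K_def c_def intro: join_image_right)
    have "up_to_mid v \<in> W \<and> h (up_to_mid v) = lower \<psi> v" if "v \<in> vertices n" for v
      using that by (cases v) (auto simp: W_def h_def)
    then show "\<forall>(u, v)\<in>fd_rel n \<psi> \<theta>. (up_to_mid u, up_to_mid v) \<in> K"
      by (auto simp: fd_rel_def K_def c_def intro: join_image_left)
  next
    fix r assume "r \<in> {r. equiv W r \<and> (\<forall>(u, v)\<in>fd_rel n \<phi> \<eta>. (low_to_mid u, low_to_mid v) \<in> r)
        \<and> (\<forall>(u, v)\<in>fd_rel n \<psi> \<theta>. (up_to_mid u, up_to_mid v) \<in> r)}"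
    then have r: "equiv W r"
      and a: "\<And>u v. (u, v) \<in> fd_rel n \<phi> \<eta> \<Longrightarrow> (low_to_mid u, low_to_mid v) \<in> r"
      and b: "\<And>u v. (u, v) \<in> fd_rel n \<psi> \<theta> \<Longrightarrow> (up_to_mid u, up_to_mid v) \<in> r"
      by auto
    have UpMid: "(Up u, Mid (\<phi> u)) \<in> r" if "u \<in> {1..n}" for u
      using a[of "Up u" "Low (\<phi> u)"] that \<phi> equiv_reflD[OF \<eta>] by (auto simp: fd_rel_def Pi_iff)
    have MidLow: "(Mid x, Low (\<psi> x)) \<in> r" if "x \<in> {1..n}" for x
      using b[of "Up x" "Low (\<psi> x)"] that \<psi> equiv_reflD[OF \<theta>] by (auto simp: fd_rel_def Pi_iff)
    \<comment> \<open>Any competing \<open>r\<close> ties each vertex to its lower end; it then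
      remains to see that \<open>r\<close> contains \<open>c\<close> on the lower row.\<close>
    have toLow: "(v, Low (h v)) \<in> r" if v: "v \<in> W" for v
    proof (cases v)
      case (Up u)
      then have "u \<in> {1..n}" "\<phi> u \<in> {1..n}" using v \<phi> by (auto simp: W_def)
      then show ?thesis using equiv_transD[OF r UpMid MidLow] \<open>v = Up u\<close> by (simp add: h_def)
    next
      case (Mid x)
      then have "x \<in> {1..n}" using v by (auto simp: W_def)
      then show ?thesis using MidLow Mid by (simp add: h_def)
    next
      case (Low x)
      then show ?thesis using equiv_reflD[OF r v] by (simp add: h_def)
    qed
    have "c \<subseteq> {(x, y). (Low x, Low y) \<in> r}"
      unfolding c_def
    proof (rule join_image_least)
      show "trans {(x, y). (Low x, Low y) \<in> r}"
        using equiv_transD[OF r] by (auto intro!: transI)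
      show "\<theta> \<subseteq> {(x, y). (Low x, Low y) \<in> r}"
      proof (rule subrelI)
        fix x y assume xy: "(x, y) \<in> \<theta>"
        then show "(x, y) \<in> {(x, y). (Low x, Low y) \<in> r}"
          using b[of "Low x" "Low y"] equiv_memD(1,2)[OF \<theta> xy] by (simp add: fd_rel_def)
      qed
      fix x y assume xy: "(x, y) \<in> \<eta>"
      then have m: "x \<in> {1..n}" "y \<in> {1..n}" using equiv_memD[OF \<eta>] by blast+
      then have "(Mid x, Mid y) \<in> r"
        using a[of "Low x" "Low y"] xy by (simp add: fd_rel_def)
      then have "(Low (\<psi> x), Low (\<psi> y)) \<in> r"
        by (rule equiv_transD[OF r equiv_transD[OF r equiv_memD(3)[OF r MidLow[OF m(1)]]] MidLow[OF m(2)]])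
      then show "(\<psi> x, \<psi> y) \<in> {(x, y). (Low x, Low y) \<in> r}" by simp
    qed
    then have low: "(x, y) \<in> c \<Longrightarrow> (Low x, Low y) \<in> r" for x y by blast
    show "K \<subseteq> r"
    proof (rule subrelI)
      fix u v assume "(u, v) \<in> K"
      then have uv: "u \<in> W" "v \<in> W" "(h u, h v) \<in> c" by (auto simp: K_def)
      show "(u, v) \<in> r"
        using equiv_transD[OF r equiv_transD[OF r toLow[OF uv(1)] low[OF uv(3)]]
            equiv_memD(3)[OF r toLow[OF uv(2)]]] .
    qed
  qed
  moreover have "K \<inter> vertices n \<times> vertices n = fd_rel n (\<psi> \<circ> \<phi>) c"
  proof -
    have "v \<in> W \<and> h v = lower (\<psi> \<circ> \<phi>) v" if "v \<in> vertices n" for v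
      using that by (cases v) (auto simp: W_def h_def)
    then show ?thesis by (auto simp: K_def fd_rel_def)
  qed
  ultimately show ?thesis
    by (simp add: part_mult_def fd_part_def c_def)
qed

section \<open>Outer classes and the partition \<open>d n \<eta>\<close>\<close>

lemma ex_consecutive:
  fixes C :: "nat set"
  assumes "finite C" "c \<in> C" "c' \<in> C" "c < x" "x < c'" "x \<notin> C"
  obtains t where "Suc t < length (sorted_list_of_set C)"
    "sorted_list_of_set C ! t < x" "x < sorted_list_of_set C ! Suc t"
proof -
  let ?j = "sorted_list_of_set C"
  obtain i k where i: "i < length ?j" "?j ! i = c" and k: "k < length ?j" "?j ! k = c'"
    using assms(1,2,3) by (metis in_set_conv_nth set_sorted_list_of_set)
  have "?j ! i < x" "\<not> ?j ! k < x" using i k assms by auto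
  moreover from this have "i < k"
    using i k sorted_nth_mono[OF sorted_sorted_list_of_set, of k i C] by (metis leI order.strict_trans1)
  \<comment> \<open>Some consecutive step of the sorted list passes \<open>x\<close>; otherwise all
    entries from index \<open>i\<close> up to \<open>k\<close> would be below \<open>x\<close>,
    including the last one.\<close>
  moreover have "\<exists>t. i \<le> t \<and> t < k \<and> ?j ! t < x \<and> \<not> ?j ! Suc t < x"
  proof (rule ccontr)
    assume neg: "\<not> ?thesis"
    have "?j ! m < x" if "i \<le> m" "m \<le> k" for m
      using that by (induction m rule: dec_induct) (use neg \<open>?j ! i < x\<close> in auto)
    then show False using \<open>i < k\<close> \<open>\<not> ?j ! k < x\<close> by auto
  qed
  ultimately obtain t where t: "i \<le> t" "t < k" "?j ! t < x" "\<not> ?j ! Suc t < x"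
    by blast
  have "?j ! Suc t \<in> C"
    using t k nth_mem[of "Suc t" ?j] assms(1) by simp
  then have "x < ?j ! Suc t" using t assms(6) by (metis linorder_neqE_nat)
  then show ?thesis using that[of t] t k by simp
qed

text \<open>A single element \<open>x\<close> decides nesting: if \<open>x\<close> lies in a gap
  between consecutive elements of \<open>C\<close>, an element of \<open>B\<close> outside that gap
  would give a chord to \<open>x\<close> crossing the chord over the gap.\<close>

lemma nested_by_iff:
  assumes eq: "equiv {1..n} \<eta>" and nc: "noncrossing \<eta>"
    and BC: "B \<in> {1..n} // \<eta>" "C \<in> {1..n} // \<eta>" "C \<noteq> B" and x: "x \<in> B"
  shows "nested_by B C \<longleftrightarrow> (\<exists>c\<in>C. \<exists>c'\<in>C. c < x \<and> x < c')"
proof -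
  let ?j = "sorted_list_of_set C"
  have fin: "finite B" "finite C"
    using in_quotient_imp_subset[OF eq] BC by (meson finite_atLeastAtMost finite_subset)+
  have rel: "(p, q) \<in> \<eta>" if "p \<in> D" "q \<in> D" "D \<in> {1..n} // \<eta>" for p q D
    using quotient_eq_iff[OF eq that(3,3,1,2)] by simp
  have nrel: "(p, q) \<notin> \<eta>" if "p \<in> B" "q \<in> C" for p q
    using quotient_eq_iff[OF eq BC(1,2) that] BC(3) by auto
  have mem: "?j ! i \<in> C" if "i < length ?j" for i
    using that fin nth_mem[of i ?j] by simp
  show ?thesis
  proof
    assume "nested_by B C"
    then obtain t where t: "Suc t < length ?j" "?j ! t < Min B" "Max B < ?j ! Suc t"
      unfolding nested_by_def by (auto simp: Let_def)
    have "Min B \<le> x" "x \<le> Max B" using fin x by auto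
    then show "\<exists>c\<in>C. \<exists>c'\<in>C. c < x \<and> x < c'"
      using t mem[of t] mem[of "Suc t"] by (meson Suc_lessD order.strict_trans1 order.strict_trans2)
  next
    assume "\<exists>c\<in>C. \<exists>c'\<in>C. c < x \<and> x < c'"
    moreover have "x \<notin> C" using nrel[OF x] rel[OF x x BC(1)] by blast
    ultimately obtain t where t: "Suc t < length ?j" "?j ! t < x" "x < ?j ! Suc t"
      using ex_consecutive[OF fin(2)] by blast
    have m: "?j ! t \<in> C" "?j ! Suc t \<in> C" using mem t by auto
    have between: "?j ! t < b \<and> b < ?j ! Suc t" if b: "b \<in> B" for b
    proof (rule ccontr)
      assume "\<not> (?j ! t < b \<and> b < ?j ! Suc t)"
      moreover have "b \<noteq> ?j ! t" "b \<noteq> ?j ! Suc t"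
        using nrel[OF b] rel[OF b b BC(1)] m by metis+
      ultimately consider "b < ?j ! t" | "?j ! Suc t < b" by linarith
      then show False
      proof cases
        case 1
        then show False
          using noncrossingD[OF nc rel[OF b x BC(1)] rel[OF m BC(2)]] t nrel[OF b m(1)] by blast
      next
        case 2
        then have "(?j ! t, x) \<in> \<eta>"
          using noncrossingD[OF nc rel[OF m BC(2)] rel[OF x b BC(1)]] t by blast
        then show False using nrel[OF x m(1)] equiv_memD(3)[OF eq] by blast
      qed
    qed
    have "Min B \<in> B" "Max B \<in> B"
      using Min_in[OF fin(1)] Max_in[OF fin(1)] x by blast+
    then show "nested_by B C"
      unfolding nested_by_def Let_def using t(1) between by blast
  qed
qed

lemma outer_classes_iff:
  assumes eq: "equiv {1..n} \<eta>" and nc: "noncrossing \<eta>" and B: "B \<in> {1..n} // \<eta>" and x: "x \<in> B"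
  shows "B \<in> outer_classes n \<eta> \<longleftrightarrow> exposed \<eta> x"
proof
  assume out: "B \<in> outer_classes n \<eta>"
  show "exposed \<eta> x"
    unfolding exposed_def
  proof (intro allI impI)
    fix p q assume *: "p < x \<and> x < q \<and> (p, q) \<in> \<eta>"
    define C where "C = \<eta> `` {p}"
    have C: "C \<in> {1..n} // \<eta>" "p \<in> C" "q \<in> C"
      using * equiv_memD[OF eq] equiv_reflD[OF eq] unfolding C_def by (auto intro!: quotientI)
    have "\<not> nested_by B C" if "C \<noteq> B"
      using out that C(1) unfolding outer_classes_def by blast
    then have "C = B"
      using nested_by_iff[OF eq nc B C(1) _ x] C(2,3) * by blast
    then show "(p, x) \<in> \<eta>" using x unfolding C_def by blast
  qed
next
  assume ex: "exposed \<eta> x"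
  have "\<not> nested_by B C" if C: "C \<in> {1..n} // \<eta>" "C \<noteq> B" for C
  proof
    assume "nested_by B C"
    then obtain c c' where c: "c \<in> C" "c' \<in> C" "c < x" "x < c'"
      using nested_by_iff[OF eq nc B C x] by blast
    then have "(c, x) \<in> \<eta>"
      using exposedD[OF ex] quotient_eq_iff[OF eq C(1) C(1)] by blast
    then show False using quotient_eq_iff[OF eq C(1) B c(1) x] C(2) by blast
  qed
  then show "B \<in> outer_classes n \<eta>"
    using B unfolding outer_classes_def by blast
qed

text \<open>Every \<open>\<eta>\<close>-class is hit by a lower vertex, so the classes index the
  blocks. This is the form in which \<open>d\<close> is written.\<close>

lemma fd_part_eq_image:
  assumes eq: "equiv {1..n} \<eta>" and \<phi>: "\<phi> \<in> {1..n} \<rightarrow> {1..n}"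
  shows "fd_part n \<phi> \<eta> = (\<lambda>B. Up ` {u \<in> {1..n}. \<phi> u \<in> B} \<union> Low ` B) ` ({1..n} // \<eta>)"
    (is "_ = ?f ` _")
proof -
  have cls: "fd_rel n \<phi> \<eta> `` {v} = ?f (\<eta> `` {lower \<phi> v})" if v: "v \<in> vertices n" for v
  proof (rule set_eqI)
    fix w
    show "w \<in> fd_rel n \<phi> \<eta> `` {v} \<longleftrightarrow> w \<in> ?f (\<eta> `` {lower \<phi> v})"
      using v equiv_memD(2)[OF eq] by (cases w) (auto simp: fd_rel_def simp del: atLeastAtMost_iff)
  qed
  have low: "lower \<phi> ` vertices n = {1..n}"
  proof (intro subset_antisym subsetI)
    show "x \<in> lower \<phi> ` vertices n" if "x \<in> {1..n}" for x
      using that by (intro image_eqI[of _ _ "Low x"]) simp_all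
  qed (use lower_mem[OF \<phi>] in blast)
  have "fd_part n \<phi> \<eta> = (\<lambda>v. ?f (\<eta> `` {lower \<phi> v})) ` vertices n"
    unfolding fd_part_def quotient_def using cls by auto
  also have "\<dots> = ?f ` (\<lambda>x. \<eta> `` {x}) ` lower \<phi> ` vertices n"
    by (simp add: image_image)
  also have "(\<lambda>x. \<eta> `` {x}) ` lower \<phi> ` vertices n = {1..n} // \<eta>"
    unfolding low quotient_def by auto
  finally show ?thesis .
qed

text \<open>The upper vertices attached to an outer class are exactly those in its span, because
  \<open>hull_min \<eta>\<close> is constant there up to \<open>\<eta>\<close>. Other classes
  receive none, since hull minima are exposed.\<close>

lemma d_eq_fd_part:
  assumes eq: "equiv {1..n} \<eta>" and nc: "noncrossing \<eta>"
  shows "d n \<eta> = fd_part n (hull_min \<eta>) \<eta>"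
proof -
  let ?U = "\<lambda>B. {u \<in> {1..n}. hull_min \<eta> u \<in> B}"
  let ?O = "outer_classes n \<eta>"
  have sub: "?O \<subseteq> {1..n} // \<eta>" unfolding outer_classes_def by blast
  have outer: "?U B = {Min B..Max B}" if B: "B \<in> ?O" for B
  proof -
    have Bq: "B \<in> {1..n} // \<eta>" using B sub by blast
    have BA: "B \<subseteq> {1..n}" "B \<noteq> {}"
      using in_quotient_imp_subset[OF eq Bq] in_quotient_imp_non_empty[OF eq Bq] by auto
    then have fin: "finite B" by (auto intro: finite_subset)
    have mM: "Min B \<in> B" "Max B \<in> B" using fin BA by auto
    have rel: "(p, q) \<in> \<eta>" if "p \<in> B" "q \<in> B" for p q
      using quotient_eq_iff[OF eq Bq Bq that] by simp
    have closed: "q \<in> B" if "p \<in> B" "(p, q) \<in> \<eta>" for p q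
      using in_quotient_imp_closed[OF eq Bq that] .
    have ex: "exposed \<eta> (Min B)"
      using outer_classes_iff[OF eq nc Bq mM(1)] B by blast
    show ?thesis
    proof (intro subset_antisym subsetI)
      fix u assume u: "u \<in> ?U B"
      then obtain z where z: "hull_min \<eta> u \<le> u" "u \<le> z" "(hull_min \<eta> u, z) \<in> \<eta>"
        using hull_minE[OF eq] by blast
      then have "z \<in> B" using closed u by blast
      then show "u \<in> {Min B..Max B}"
        using u z Min_le[OF fin, of "hull_min \<eta> u"] Max_ge[OF fin, of z] by auto
    next
      fix u assume u: "u \<in> {Min B..Max B}"
      then have un: "u \<in> {1..n}" using mM BA by fastforce
      have "hull_min \<eta> u = hull_min \<eta> (Min B)"
        using hull_min_between[OF eq nc rel[OF mM] un] u by simp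
      moreover have "(hull_min \<eta> (Min B), Min B) \<in> \<eta>"
        using hull_min_related[OF eq _ ex] mM BA by blast
      ultimately show "u \<in> ?U B"
        using closed[OF mM(1)] equiv_memD(3)[OF eq] un by auto
    qed
  qed
  have inner: "?U C = {}" if C: "C \<in> {1..n} // \<eta> - ?O" for C
  proof (rule equals0I)
    fix u assume "u \<in> ?U C"
    then show False
      using outer_classes_iff[OF eq nc, of C "hull_min \<eta> u"] exposed_hull_min[OF eq nc, of u] C by simp
  qed
  have "fd_part n (hull_min \<eta>) \<eta> = (\<lambda>B. Up ` ?U B \<union> Low ` B) ` (?O \<union> ({1..n} // \<eta> - ?O))"
    using fd_part_eq_image[OF eq, of "hull_min \<eta>"] hull_min_mem[OF eq] sub by (simp add: Un_absorb1)
  also have "\<dots> = d n \<eta>"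
    unfolding d_def image_Un using outer inner by (intro arg_cong2[of _ _ _ _ "(\<union>)"] image_cong) auto
  finally show ?thesis ..
qed

text \<open>The laws are proved on this set, which contains \<open>planar_fd n\<close> and is closed
  under products and \<open>\<rho>\<close>, so no drawing of a product has to be
  constructed.\<close>

definition fd_parts :: "nat \<Rightarrow> partition set" where
  "fd_parts n = {fd_part n \<phi> \<eta> | \<phi> \<eta>. admissible n \<phi> \<eta>}"

lemma planar_fd_subset_fd_parts: "planar_fd n \<subseteq> fd_parts n"
proof
  fix a assume "a \<in> planar_fd n"
  then have p: "a \<in> partitions n" and pl: "planar_partition n a" and fd: "full_domain n a"
    unfolding planar_fd_def by auto
  have po: "partition_on (vertices n) a" using p unfolding partitions_def by simp
  define r where "r = {(x, y). \<exists>B\<in>a. x \<in> B \<and> y \<in> B}"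
  have r: "equiv (vertices n) r" "vertices n // r = a"
    unfolding r_def using equiv_partition_on[OF po] partition_on_eq_quotient[OF po] by auto
  note cross = planar_partition_crossing[OF pl p]
  define \<eta> where "\<eta> = coker n a"
  \<comment> \<open>The least choice depends only on the block of \<open>Up u\<close>. If
    \<open>\<phi>\<close> reversed two upper vertices, the third crossing pattern would put them in
    one block, contradicting minimality.\<close>
  define \<phi> where "\<phi> u = (LEAST x. (Up u, Low x) \<in> r)" for u
  have \<eta>_iff: "(x, y) \<in> \<eta> \<longleftrightarrow> (Low x, Low y) \<in> r" for x y
  proof -
    have "x \<in> {1..n} \<and> y \<in> {1..n}" if "(Low x, Low y) \<in> r"
      using equiv_memD(1,2)[OF r(1) that] by simp
    then show ?thesis by (auto simp: \<eta>_def coker_def r_def)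
  qed
  have \<phi>: "(Up u, Low (\<phi> u)) \<in> r" if u: "u \<in> {1..n}" for u
  proof -
    have "\<exists>x. (Up u, Low x) \<in> r" using fd u unfolding full_domain_def r_def by blast
    then show ?thesis unfolding \<phi>_def by (rule LeastI_ex)
  qed
  have \<phi>_mem: "\<phi> \<in> {1..n} \<rightarrow> {1..n}"
  proof
    show "\<phi> u \<in> {1..n}" if "u \<in> {1..n}" for u
      using equiv_memD(2)[OF r(1) \<phi>[OF that]] by simp
  qed
  have "fd_rel n \<phi> \<eta> = r"
  proof -
    have low: "(v, Low (lower \<phi> v)) \<in> r" if "v \<in> vertices n" for v
      using that \<phi> equiv_reflD[OF r(1) that] by (cases v) auto
    have "(u, v) \<in> fd_rel n \<phi> \<eta> \<longleftrightarrow> (u, v) \<in> r" for u v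
    proof (cases "u \<in> vertices n \<and> v \<in> vertices n")
      case True
      then show ?thesis
        using equiv_related_cong[OF r(1) low low, of u v] unfolding fd_rel_def by (simp add: \<eta>_iff)
    next
      case False
      then show ?thesis using equiv_memD(1,2)[OF r(1), of u v] by (auto simp: fd_rel_def)
    qed
    then show ?thesis by auto
  qed
  then have "a = fd_part n \<phi> \<eta>" using r(2) by (simp add: fd_part_def)
  moreover have "admissible n \<phi> \<eta>"
    unfolding admissible_def
  proof (intro conjI ballI)
    show "equiv {1..n} \<eta>"
    proof (rule equivI)
      show "\<eta> \<subseteq> {1..n} \<times> {1..n}" unfolding \<eta>_def coker_def by auto
      show "refl_on {1..n} \<eta>" using equiv_reflD[OF r(1)] by (auto intro!: refl_onI simp: \<eta>_iff)
      show "sym \<eta>" using equiv_memD(3)[OF r(1)] by (auto intro!: symI simp: \<eta>_iff)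
      show "trans \<eta>" using equiv_transD[OF r(1)] by (auto intro!: transI simp: \<eta>_iff)
    qed
    show "noncrossing \<eta>"
      unfolding noncrossing_def \<eta>_iff
    proof (intro allI impI, elim conjE)
      fix p q s t assume *: "p < q" "q < s" "s < t" "(Low p, Low s) \<in> r" "(Low q, Low t) \<in> r"
      obtain B C where BC: "B \<in> a" "C \<in> a" "Low p \<in> B" "Low s \<in> B" "Low q \<in> C" "Low t \<in> C"
        using *(4,5) unfolding r_def by blast
      have "B = C" using cross(1)[OF BC *(1-3)] .
      then show "(Low p, Low q) \<in> r" using BC unfolding r_def by blast
    qed
    show "\<phi> \<in> {1..n} \<rightarrow> {1..n}" by (rule \<phi>_mem)
    show "mono_on {1..n} \<phi>"
    proof (rule mono_onI)
      fix u v assume uv: "u \<in> {1..n}" "v \<in> {1..n}" "u \<le> v"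
      show "\<phi> u \<le> \<phi> v"
      proof (rule ccontr)
        assume "\<not> \<phi> u \<le> \<phi> v"
        then have *: "u < v" "\<phi> v < \<phi> u" using uv by (auto simp: le_less)
        obtain B C where BC: "B \<in> a" "C \<in> a" "Up u \<in> B" "Low (\<phi> u) \<in> B" "Up v \<in> C" "Low (\<phi> v) \<in> C"
          using \<phi>[OF uv(1)] \<phi>[OF uv(2)] unfolding r_def by blast
        have "B = C" using cross(3)[OF BC(1,2,4,3,6,5) *] .
        then have "(Up u, Low (\<phi> v)) \<in> r" using BC unfolding r_def by blast
        then have "\<phi> u \<le> \<phi> v" unfolding \<phi>_def[of u] by (rule Least_le)
        then show False using * by simp
      qed
    qed
    show "exposed \<eta> (\<phi> u)" if u: "u \<in> {1..n}" for u
      unfolding exposed_def \<eta>_iff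
    proof (intro allI impI)
      fix p q assume *: "p < \<phi> u \<and> \<phi> u < q \<and> (Low p, Low q) \<in> r"
      then obtain B C where BC: "B \<in> a" "C \<in> a" "Low p \<in> B" "Low q \<in> B" "Up u \<in> C" "Low (\<phi> u) \<in> C"
        using \<phi>[OF u] unfolding r_def by blast
      have "B = C" using cross(2)[OF BC(1,2,3,4,6,5)] * by blast
      then show "(Low p, Low (\<phi> u)) \<in> r" using BC unfolding r_def by blast
    qed
  qed
  ultimately show "a \<in> fd_parts n" unfolding fd_parts_def by blast
qed

lemma fd_partsE:
  assumes "a \<in> fd_parts n"
  obtains \<phi> \<eta> where "a = fd_part n \<phi> \<eta>" "admissible n \<phi> \<eta>"
  using assms by (auto simp: fd_parts_def)

lemma fd_partsI: "admissible n \<phi> \<eta> \<Longrightarrow> fd_part n \<phi> \<eta> \<in> fd_parts n"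
  by (auto simp: fd_parts_def)

lemma \<rho>_fd_part:
  assumes "admissible n \<phi> \<eta>"
  shows "\<rho> n (fd_part n \<phi> \<eta>) = fd_part n (hull_min \<eta>) \<eta>"
  unfolding \<rho>_def coker_fd_part[OF admissibleD(1,3)[OF assms]] by (rule d_eq_fd_part[OF admissibleD(1,2)[OF assms]])

lemma mult_fd_part:
  assumes "admissible n \<phi> \<eta>" "admissible n \<psi> \<theta>"
  shows "fd_part n \<phi> \<eta> \<odot>\<^bsub>n\<^esub> fd_part n \<psi> \<theta> = fd_part n (\<psi> \<circ> \<phi>) (join_image \<psi> \<theta> \<eta>)"
  by (rule part_mult_fd_part[OF admissibleD(1,3)[OF assms(1)] admissibleD(1,3)[OF assms(2)]])

section \<open>Closure properties and the laws on \<open>fd_parts n\<close>\<close>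

lemma \<rho>_mem: "a \<in> fd_parts n \<Longrightarrow> \<rho> n a \<in> fd_parts n"
  by (erule fd_partsE) (simp add: \<rho>_fd_part fd_partsI admissible_hull_min[OF admissibleD(1,2)])

lemma mult_mem: "a \<in> fd_parts n \<Longrightarrow> b \<in> fd_parts n \<Longrightarrow> a \<odot>\<^bsub>n\<^esub> b \<in> fd_parts n"
  by (auto elim!: fd_partsE simp: mult_fd_part intro!: fd_partsI admissible_comp)

lemma mult_assoc:
  assumes "a \<in> fd_parts n" "b \<in> fd_parts n" "c \<in> fd_parts n"
  shows "a \<odot>\<^bsub>n\<^esub> b \<odot>\<^bsub>n\<^esub> c = a \<odot>\<^bsub>n\<^esub> (b \<odot>\<^bsub>n\<^esub> c)"
  using assms
  by (auto elim!: fd_partsE simp: mult_fd_part admissible_comp join_image_assoc comp_assoc)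

lemma \<rho>_\<rho>: "a \<in> fd_parts n \<Longrightarrow> \<rho> n (\<rho> n a) = \<rho> n a"
  by (erule fd_partsE) (simp add: \<rho>_fd_part admissible_hull_min[OF admissibleD(1,2)])

text \<open>The values of \<open>\<phi>\<close> are exposed, hence related to their hull minima; the
  cokernel is unchanged.\<close>

lemma mult_\<rho>_self:
  assumes "a \<in> fd_parts n"
  shows "a \<odot>\<^bsub>n\<^esub> \<rho> n a = a"
proof -
  obtain \<phi> \<eta> where a: "a = fd_part n \<phi> \<eta>" and ad: "admissible n \<phi> \<eta>"
    using assms by (rule fd_partsE)
  note eq = admissibleD(1,2)[OF ad]
  have "(hull_min \<eta> (\<phi> u), \<phi> u) \<in> \<eta>" if "u \<in> {1..n}" for u
    using hull_min_related[OF eq(1) funcset_mem[OF admissibleD(3)[OF ad] that] admissibleD(4)[OF ad that]] .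
  then have "fd_part n (hull_min \<eta> \<circ> \<phi>) \<eta> = fd_part n \<phi> \<eta>"
    using eq(1) by (intro fd_part_cong) auto
  then show ?thesis
    by (simp add: a \<rho>_fd_part[OF ad] mult_fd_part[OF ad admissible_hull_min[OF eq]]
        join_image_hull_min[OF eq eq(1)])
qed

text \<open>\<open>\<rho>\<close> depends only on the cokernel, and both products have cokernel
  \<open>join_image \<psi> \<theta> \<eta>\<close>, in which \<open>\<phi>\<close> does not
  occur.\<close>

lemma \<rho>_mult:
  assumes "a \<in> fd_parts n" "b \<in> fd_parts n"
  shows "\<rho> n (a \<odot>\<^bsub>n\<^esub> b) = \<rho> n (\<rho> n a \<odot>\<^bsub>n\<^esub> b)"
proof -
  obtain \<phi> \<eta> where a: "a = fd_part n \<phi> \<eta>" and ad: "admissible n \<phi> \<eta>"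
    using assms(1) by (rule fd_partsE)
  note eq = admissibleD(1,2)[OF ad]
  obtain \<psi> \<theta> where b: "b = fd_part n \<psi> \<theta>" and bd: "admissible n \<psi> \<theta>"
    using assms(2) by (rule fd_partsE)
  note hd = admissible_hull_min[OF eq]
  show ?thesis
    by (simp add: a b \<rho>_fd_part ad bd hd mult_fd_part admissible_comp[OF ad bd] admissible_comp[OF hd bd])
qed

lemma \<rho>_mult_swap:
  assumes "a \<in> fd_parts n" "b \<in> fd_parts n"
  shows "\<rho> n a \<odot>\<^bsub>n\<^esub> b = b \<odot>\<^bsub>n\<^esub> \<rho> n (a \<odot>\<^bsub>n\<^esub> b)"
proof -
  obtain \<phi> \<eta> where a: "a = fd_part n \<phi> \<eta>" and ad: "admissible n \<phi> \<eta>"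
    using assms(1) by (rule fd_partsE)
  note eq = admissibleD(1,2)[OF ad]
  obtain \<psi> \<theta> where b: "b = fd_part n \<psi> \<theta>" and bd: "admissible n \<psi> \<theta>"
    using assms(2) by (rule fd_partsE)
  note \<theta> = admissibleD(1)[OF bd]
  define c where "c = join_image \<psi> \<theta> \<eta>"
  have cd: "admissible n (\<psi> \<circ> \<phi>) c"
    unfolding c_def by (rule admissible_comp[OF ad bd])
  note c = admissibleD(1,2)[OF cd]
  \<comment> \<open>Hence right multiplication of \<open>b\<close> by the partition with cokernel
    \<open>c\<close> again gives cokernel \<open>c\<close>, and only the attaching maps remain to be
    compared modulo \<open>c\<close>.\<close>
  have "\<theta> \<subseteq> c" unfolding c_def by (auto intro: join_image_left)
  then have "b \<odot>\<^bsub>n\<^esub> \<rho> n (a \<odot>\<^bsub>n\<^esub> b) = fd_part n (hull_min c \<circ> \<psi>) c"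
    using join_image_hull_min[OF c \<theta>]
    by (simp add: a b mult_fd_part ad bd \<rho>_fd_part[OF cd] admissible_hull_min[OF c] flip: c_def)
  moreover have "\<rho> n a \<odot>\<^bsub>n\<^esub> b = fd_part n (\<psi> \<circ> hull_min \<eta>) c"
    by (simp add: a b mult_fd_part ad bd \<rho>_fd_part[OF ad] admissible_hull_min[OF eq] flip: c_def)
  moreover have "fd_part n (\<psi> \<circ> hull_min \<eta>) c = fd_part n (hull_min c \<circ> \<psi>) c"
    by (rule fd_part_cong[OF c(1)]) (simp add: c_def comp_hull_min_related[OF bd eq] del: atLeastAtMost_iff)
  ultimately show ?thesis by simp
qed

text \<open>By \<open>comp_hull_min_related\<close> for \<open>hull_min \<theta>\<close>, the
  attaching map of the product is \<open>c\<close>-related to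
  \<open>hull_min c (hull_min \<theta> u)\<close>. This equals \<open>hull_min c u\<close>, as
  \<open>u\<close> lies under a \<open>\<theta>\<close>-chord from
  \<open>hull_min \<theta> u\<close>.\<close>

lemma \<rho>_mult_\<rho>:
  assumes "a \<in> fd_parts n" "b \<in> fd_parts n"
  shows "\<rho> n (\<rho> n a \<odot>\<^bsub>n\<^esub> \<rho> n b) = \<rho> n a \<odot>\<^bsub>n\<^esub> \<rho> n b"
proof -
  obtain \<phi> \<eta> where a: "a = fd_part n \<phi> \<eta>" and ad: "admissible n \<phi> \<eta>"
    using assms(1) by (rule fd_partsE)
  note \<eta> = admissibleD(1,2)[OF ad]
  obtain \<psi> \<theta> where b: "b = fd_part n \<psi> \<theta>" and bd: "admissible n \<psi> \<theta>"
    using assms(2) by (rule fd_partsE)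
  note \<theta> = admissibleD(1,2)[OF bd]
  define c where "c = join_image (hull_min \<theta>) \<theta> \<eta>"
  note hd = admissible_hull_min[OF \<eta>] admissible_hull_min[OF \<theta>]
  have cd: "admissible n (hull_min \<theta> \<circ> hull_min \<eta>) c"
    unfolding c_def by (rule admissible_comp[OF hd])
  note c = admissibleD(1,2)[OF cd]
  have prod: "\<rho> n a \<odot>\<^bsub>n\<^esub> \<rho> n b = fd_part n (hull_min \<theta> \<circ> hull_min \<eta>) c"
    by (simp add: a b \<rho>_fd_part ad bd mult_fd_part hd c_def)
  have "(hull_min c u, (hull_min \<theta> \<circ> hull_min \<eta>) u) \<in> c" if u: "u \<in> {1..n}" for u
  proof -
    obtain z where z: "hull_min \<theta> u \<le> u" "u \<le> z" "(hull_min \<theta> u, z) \<in> \<theta>"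
      using hull_minE[OF \<theta>(1) u] .
    have "(hull_min \<theta> u, z) \<in> c" using z(3) unfolding c_def by (rule join_image_left)
    then have "hull_min c u = hull_min c (hull_min \<theta> u)"
      using hull_min_between[OF c _ u] z by blast
    then show ?thesis
      using comp_hull_min_related[OF hd(2) \<eta> u] equiv_memD(3)[OF c(1)] by (simp add: c_def)
  qed
  then show ?thesis
    unfolding prod \<rho>_fd_part[OF cd] by (rule fd_part_cong[OF c(1)])
qed

theorem proposition9p45:
  fixes n :: nat and a b :: partition
  assumes "n \<ge> 2" and "a \<in> planar_fd n" and "b \<in> planar_fd n"
  shows "a \<odot>\<^bsub>n\<^esub> \<rho> n a = a
       \<and> \<rho> n (\<rho> n a) = \<rho> n a
       \<and> \<rho> n a \<odot>\<^bsub>n\<^esub> \<rho> n a = \<rho> n a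
       \<and> \<rho> n a \<odot>\<^bsub>n\<^esub> \<rho> n b \<odot>\<^bsub>n\<^esub> \<rho> n a = \<rho> n b \<odot>\<^bsub>n\<^esub> \<rho> n a
       \<and> \<rho> n (\<rho> n a \<odot>\<^bsub>n\<^esub> \<rho> n b) = \<rho> n a \<odot>\<^bsub>n\<^esub> \<rho> n b
       \<and> \<rho> n (a \<odot>\<^bsub>n\<^esub> b) \<odot>\<^bsub>n\<^esub> \<rho> n b = \<rho> n (a \<odot>\<^bsub>n\<^esub> b)
       \<and> \<rho> n (a \<odot>\<^bsub>n\<^esub> b) = \<rho> n (\<rho> n a \<odot>\<^bsub>n\<^esub> b)
       \<and> \<rho> n a \<odot>\<^bsub>n\<^esub> b = b \<odot>\<^bsub>n\<^esub> \<rho> n (a \<odot>\<^bsub>n\<^esub> b)"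
proof (intro conjI)
  have a: "a \<in> fd_parts n" and b: "b \<in> fd_parts n"
    using assms planar_fd_subset_fd_parts by auto
  note ra = \<rho>_mem[OF a] and rb = \<rho>_mem[OF b] and ab = mult_mem[OF a b]
  show "a \<odot>\<^bsub>n\<^esub> \<rho> n a = a" by (rule mult_\<rho>_self[OF a])
  show "\<rho> n (\<rho> n a) = \<rho> n a" by (rule \<rho>_\<rho>[OF a])
  show "\<rho> n a \<odot>\<^bsub>n\<^esub> \<rho> n a = \<rho> n a"
    using mult_\<rho>_self[OF ra] \<rho>_\<rho>[OF a] by simp
  show G5: "\<rho> n (\<rho> n a \<odot>\<^bsub>n\<^esub> \<rho> n b) = \<rho> n a \<odot>\<^bsub>n\<^esub> \<rho> n b" by (rule \<rho>_mult_\<rho>[OF a b])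
  show "\<rho> n (a \<odot>\<^bsub>n\<^esub> b) = \<rho> n (\<rho> n a \<odot>\<^bsub>n\<^esub> b)" by (rule \<rho>_mult[OF a b])
  show "\<rho> n a \<odot>\<^bsub>n\<^esub> b = b \<odot>\<^bsub>n\<^esub> \<rho> n (a \<odot>\<^bsub>n\<^esub> b)" by (rule \<rho>_mult_swap[OF a b])
  \<comment> \<open>(G4): apply (G8) to \<open>b\<close> and \<open>\<rho> n a\<close>, then
    simplify the new factor by (G7) and (G5); this rewrites the right-hand side into the
    left.\<close>
  have "\<rho> n b \<odot>\<^bsub>n\<^esub> \<rho> n a = \<rho> n a \<odot>\<^bsub>n\<^esub> \<rho> n (b \<odot>\<^bsub>n\<^esub> \<rho> n a)"
    by (rule \<rho>_mult_swap[OF b ra])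
  also have "\<dots> = \<rho> n a \<odot>\<^bsub>n\<^esub> (\<rho> n b \<odot>\<^bsub>n\<^esub> \<rho> n a)"
    using \<rho>_mult[OF b ra] \<rho>_mult_\<rho>[OF b a] by simp
  finally show "\<rho> n a \<odot>\<^bsub>n\<^esub> \<rho> n b \<odot>\<^bsub>n\<^esub> \<rho> n a = \<rho> n b \<odot>\<^bsub>n\<^esub> \<rho> n a"
    using mult_assoc[OF ra rb ra] by simp
  \<comment> \<open>(G6): (G5) wraps the product in \<open>\<rho>\<close>, (G7) removes the inner
    \<open>\<rho>\<close>, and (G1) absorbs \<open>\<rho> n b\<close> into \<open>b\<close>.\<close>
  have "\<rho> n (a \<odot>\<^bsub>n\<^esub> b) \<odot>\<^bsub>n\<^esub> \<rho> n b = \<rho> n (\<rho> n (a \<odot>\<^bsub>n\<^esub> b) \<odot>\<^bsub>n\<^esub> \<rho> n b)"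
    using \<rho>_mult_\<rho>[OF ab b] by simp
  also have "\<dots> = \<rho> n (a \<odot>\<^bsub>n\<^esub> b \<odot>\<^bsub>n\<^esub> \<rho> n b)"
    by (rule \<rho>_mult[OF ab rb, symmetric])
  also have "\<dots> = \<rho> n (a \<odot>\<^bsub>n\<^esub> b)"
    using mult_assoc[OF a b rb] mult_\<rho>_self[OF b] by simp
  finally show "\<rho> n (a \<odot>\<^bsub>n\<^esub> b) \<odot>\<^bsub>n\<^esub> \<rho> n b = \<rho> n (a \<odot>\<^bsub>n\<^esub> b)" .
qed

end
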